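(* In the setting described in the context, let $h_0\in L^1(\mathbb{R}^M,e^{-\pi|\mathbf v|^2}\mathrm{d}\mathbf v)$ be nonnegative with $\mathcal S(h_0)<\infty$. Then for all $k$, $\underline\alpha$, $\underline\theta$, $$\mathcal S\big(g_k(\cdot,\underline\alpha,\underline\theta)\big)\le\sum_{\sigma\subset\{1,\dots,M\}}\prod_{i\in\sigma^c}\gamma_{k,i}^2\prod_{j\in\sigma}(1-\gamma_{k,j}^2)\int_{\mathbb{R}^M}h_0(\mathbf v)\log h^\sigma_{0,U_k(\underline\alpha,\underline\theta)}\big(P_{\sigma^c}U_k(\underline\alpha,\underline\theta)^T\mathbf v\big)e^{-\pi|\mathbf v|^2}\,\mathrm{d}\mathbf v,$$ where $\sigma^c$ is the complement of $\sigma$ in $\{1,\dots,M\}$.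
   Context: Setting: $M,N$ positive integers, $\lambda_S,\lambda_R,\mu>0$, $\rho$ a probability density on $[-\pi,\pi]$. For a pair $\alpha=(i,j)$, $1\le i<j\le M+N$, $r_\alpha(\theta)$ is the rotation of $\mathbb{R}^{M+N}$ in the $(i,j)$ coordinate plane such that $r_\alpha(\theta)^{-1}\mathbf z$ has $i$-th coordinate $z_i\cos\theta-z_j\sin\theta$ and $j$-th coordinate $z_i\sin\theta+z_j\cos\theta$. For $\underline\alpha=(\alpha_1,\dots,\alpha_k)$, $\underline\theta=(\theta_1,\dots,\theta_k)$, let $A_k(\underline\alpha,\underline\theta)$ be the upper-left $M\times M$ block of $[\prod_{l=1}^kr_{\alpha_l}(\theta_l)]^{-1}$, with singular value decomposition $A_k=U_k\Gamma_kV_k^T$, $U_k,V_k$ orthogonal, $\Gamma_k=\mathrm{diag}(\gamma_{k,1},\dots,\gamma_{k,M})$, $\gamma_{k,j}\in[0,1]$. For an orthogonal $U$ let $h_{0,U}(\mathbf x)=h_0(U\mathbf x)$, and define $$g_k(\mathbf v,\underline\alpha,\underline\theta)=\int_{\mathbb{R}^M}h_{0,U_k}\big(\Gamma_k\mathbf v+(I_M-\Gamma_k^2)^{1/2}\mathbf w\big)e^{-\pi|\mathbf w|^2}\,\mathrm{d}\mathbf w.$$ Entropy: $\mathcal S(h)=\int h\log h\,e^{-\pi|\mathbf x|^2}\mathrm{d}\mathbf x$ (over the appropriate Euclidean space). For a function $h$ of $M$ variables and $\sigma\subset\{1,\dots,M\}$, the marginal $h^\sigma$ is the function of the variables $v_j$,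 $j\in\sigma^c$, obtained by integrating $h$ against $\prod_{j\in\sigma}e^{-\pi v_j^2}\mathrm{d}v_j$. $P_{\sigma^c}:\mathbb{R}^M\to\mathbb{R}^{|\sigma^c|}$ is the coordinate projection $\mathbf v\mapsto(v_j)_{j\in\sigma^c}$. *)

theory Defs
  imports "HOL-Probability.Probability" "Jordan_Normal_Form.Gauss_Jordan_Elimination"
begin

text \<open>Points of R^M are functions nat => real, extensional on the index set {..<M}
  (elements of the product space PiE {..<M} UNIV); coordinates are 0-indexed.\<close>

definition gauss1 :: "real measure" where
  "gauss1 = density lborel (\<lambda>x. ennreal (exp (- pi * x^2)))"

definition gaussM :: "nat set \<Rightarrow> (nat \<Rightarrow> real) measure" where
  "gaussM I = PiM I (\<lambda>_. gauss1)"

definition entropy :: "nat \<Rightarrow> ((nat \<Rightarrow> real) \<Rightarrow> real) \<Rightarrow> real" where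
  "entropy M h = (\<integral>x. h x * ln (h x) \<partial>gaussM {..<M})"

definition marginal :: "nat \<Rightarrow> nat set \<Rightarrow> ((nat \<Rightarrow> real) \<Rightarrow> real) \<Rightarrow> (nat \<Rightarrow> real) \<Rightarrow> real" where
  "marginal M \<sigma> h = (\<lambda>u. \<integral>w. h (merge \<sigma> ({..<M} - \<sigma>) (w, u)) \<partial>gaussM \<sigma>)"

definition proj_c :: "nat \<Rightarrow> nat set \<Rightarrow> (nat \<Rightarrow> real) \<Rightarrow> (nat \<Rightarrow> real)" where
  "proj_c M \<sigma> v = restrict v ({..<M} - \<sigma>)"

definition mat_app :: "real mat \<Rightarrow> (nat \<Rightarrow> real) \<Rightarrow> (nat \<Rightarrow> real)" where
  "mat_app U x = (\<lambda>i. if i < dim_row U then (\<Sum>j<dim_col U. U $$ (i,j) * x j) else undefined)"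

definition orthogonal_real :: "nat \<Rightarrow> real mat \<Rightarrow> bool" where
  "orthogonal_real n U \<longleftrightarrow> U \<in> carrier_mat n n \<and> transpose_mat U * U = 1\<^sub>m n \<and> U * transpose_mat U = 1\<^sub>m n"

definition rot_inv :: "nat \<Rightarrow> nat \<times> nat \<Rightarrow> real \<Rightarrow> real mat" where
  "rot_inv n \<alpha> \<theta> = (case \<alpha> of (i,j) \<Rightarrow> mat n n (\<lambda>(a,b).
      if a = i \<and> b = i then cos \<theta>
      else if a = i \<and> b = j then - sin \<theta>
      else if a = j \<and> b = i then sin \<theta>
      else if a = j \<and> b = j then cos \<theta>
      else if a = b then 1 else 0))"

definition rot :: "nat \<Rightarrow> nat \<times> nat \<Rightarrow> real \<Rightarrow> real mat" where
  "rot n \<alpha> \<theta> = the (mat_inverse (rot_inv n \<alpha> \<theta>))"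

definition rot_prod :: "nat \<Rightarrow> (nat \<times> nat) list \<Rightarrow> real list \<Rightarrow> real mat" where
  "rot_prod n \<alpha>s \<theta>s = foldr (\<lambda>(\<alpha>, \<theta>) P. rot n \<alpha> \<theta> * P) (zip \<alpha>s \<theta>s) (1\<^sub>m n)"

definition A_blk :: "nat \<Rightarrow> nat \<Rightarrow> (nat \<times> nat) list \<Rightarrow> real list \<Rightarrow> real mat" where
  "A_blk M N \<alpha>s \<theta>s = (let Q = the (mat_inverse (rot_prod (M + N) \<alpha>s \<theta>s))
      in mat M M (\<lambda>(i,j). Q $$ (i,j)))"

definition hU :: "((nat \<Rightarrow> real) \<Rightarrow> real) \<Rightarrow> real mat \<Rightarrow> (nat \<Rightarrow> real) \<Rightarrow> real" where
  "hU h U x = h (mat_app U x)"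

definition g_fun :: "nat \<Rightarrow> ((nat \<Rightarrow> real) \<Rightarrow> real) \<Rightarrow> real mat \<Rightarrow> real mat \<Rightarrow> (nat \<Rightarrow> real) \<Rightarrow> real" where
  "g_fun M h U \<Gamma> v = (\<integral>w. hU h U (\<lambda>i. if i < M then \<Gamma> $$ (i,i) * v i + sqrt (1 - (\<Gamma> $$ (i,i))^2) * w i
                                   else undefined) \<partial>gaussM {..<M})"

end

theory Submission
  imports Defs
begin

text \<open>
  By rotation invariance of the Gaussian, the right-hand side is a combination of the entropies of
  the marginals of \<open>h = h\<^sub>0 \<circ> U\<close>, and \<open>g\<close> arises from \<open>h\<close> by applying in every coordinate the Mehler
  operator \<open>P f (v) = \<integral> f (a v + b w) d\<gamma>(w)\<close> with \<open>a = \<gamma>\<^sub>i\<close> and \<open>a\<^sup>2 + b\<^sup>2 = 1\<close>. Applying the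
  one-dimensional inequality \<open>S(P f) \<le> a\<^sup>2 S(f) + b\<^sup>2 m ln m\<close>, \<open>m = \<integral> f d\<gamma>\<close>, in one coordinate at a time
  gives the theorem.

  The one-dimensional inequality is proved by transport. Let \<open>T\<close> be the increasing map carrying \<open>\<gamma>\<close>
  to \<open>f \<gamma>\<close>, let \<open>x\<close>, \<open>w\<close> be independent Gaussians and put \<open>y = a x + b w\<close>, \<open>z = b x - a w\<close>, again
  independent Gaussians. For fixed \<open>z\<close> the map \<open>y \<mapsto> R = a T(x) + b w\<close> is increasing with derivative
  \<open>a\<^sup>2 T'(x) + b\<^sup>2\<close>, so Gibbs' inequality bounds \<open>\<integral> ln (P f (R))\<close>, which equals \<open>S(P f)\<close>, and concavity
  of the logarithm, \<open>ln (a\<^sup>2 T' + b\<^sup>2) \<ge> a\<^sup>2 ln T'\<close>, produces the factor \<open>a\<^sup>2\<close>.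
\<close>

subsection \<open>The Gaussian measure on the line and its rotation invariance\<close>

text \<open>The choice of R makes all quadratic exponents cancel. With p the Gaussian density,
  Gibbs' inequality contributes pi y^2 - pi R^2, and T' = p / (f p)(T) contributes a^2 (pi x^2 - pi
  T^2). Besides a^2 ln f(T(x)) there remains only 2 pi a b w (T(x) - x), whose mean is zero because
  w is centred and independent of x. That S(P f) is the mean of ln (P f (R)) rests on the symmetry
  of P: integrating P f against psi is integrating f(x) psi(a x + b w), and T absorbs the weight f.
  The map T is differentiable when f is continuous and positive. The inequality is therefore proved
  for continuous f with positive bounds and mass 1, and extended by scaling, by bounded limits and
  by truncation. In the last extension the left side passes to the limit only as an inequality
  (Fatou), in the direction that is needed. In the theorem, sigma records the coordinates that were
  averaged (factor b^2); the others were kept (factor a^2).\<close>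

lemma sets_gauss1 [measurable_cong, simp]: "sets gauss1 = sets borel"
  by (simp add: gauss1_def)

lemma space_gauss1 [simp]: "space gauss1 = UNIV"
  by (simp add: gauss1_def)

text \<open>With variance 1/(2 pi) the normalizing factor of the normal density is 1, so total mass
  and moments come from the normal distribution.\<close>

lemma gauss1_eq_normal: "gauss1 = density lborel (\<lambda>x. ennreal (normal_density 0 (1 / sqrt (2 * pi)) x))"
proof -
  have "2 * pi * (1 / sqrt (2 * pi))\<^sup>2 = 1" "2 * (1 / sqrt (2 * pi))\<^sup>2 = 1 / pi"
    by (simp_all add: power_divide)
  then have "normal_density 0 (1 / sqrt (2 * pi)) x = exp (- pi * x\<^sup>2)" for x
    unfolding normal_density_def by (simp add: mult.commute)
  then show ?thesis
    unfolding gauss1_def by simp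
qed

interpretation gauss1: prob_space gauss1
  unfolding gauss1_eq_normal by (rule prob_space_normal_density) simp

interpretation gauss1_pair: pair_prob_space gauss1 gauss1 ..

lemma gauss1_UNIV [simp]: "emeasure gauss1 UNIV = 1" "measure gauss1 UNIV = 1"
  using gauss1.emeasure_space_1 gauss1.prob_space by simp_all

lemma nn_integral_gauss1:
  assumes "f \<in> borel_measurable borel"
  shows "(\<integral>\<^sup>+x. f x \<partial>gauss1) = (\<integral>\<^sup>+x. f x * ennreal (exp (- pi * x\<^sup>2)) \<partial>lborel)"
  unfolding gauss1_def using assms by (subst nn_integral_density) (auto simp: mult.commute)

lemma AE_gauss1_iff: "(AE x in gauss1. P x) \<longleftrightarrow> (AE x in lborel. P x)"
  unfolding gauss1_def by (subst AE_density) auto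

text \<open>The vanishing mean removes the cross term that the transport argument leaves
  over.\<close>

lemma integrable_gauss1_id: "integrable gauss1 (\<lambda>x. x)"
  and integral_gauss1_id: "(\<integral>x. x \<partial>gauss1) = 0"
proof -
  let ?s = "1 / sqrt (2 * pi)"
  have "integrable lborel (\<lambda>x. normal_density 0 ?s x * x)"
    using integrable_normal_moment_nz_1[of ?s 0] by simp
  then show "integrable gauss1 (\<lambda>x. x)"
    unfolding gauss1_eq_normal by (subst integrable_density) auto
  have "(\<integral>x. normal_density 0 ?s x * x \<partial>lborel) = 0"
    using integral_normal_moment_nz_1[of ?s 0] by simp
  then show "(\<integral>x. x \<partial>gauss1) = 0"
    unfolding gauss1_eq_normal by (subst integral_density) auto
qed

text \<open>Two one-dimensional substitutions: u = a x + b w at fixed x, with factor 1/|b|, and,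
  after exchanging the integrals, v = (x - a u)/b at fixed u, with factor |b|. The first one
  degenerates for b = 0, where the map only changes signs.\<close>

lemma nn_integral_lborel_rotate:
  fixes \<psi> :: "real \<times> real \<Rightarrow> ennreal"
  assumes [measurable]: "\<psi> \<in> borel_measurable (borel \<Otimes>\<^sub>M borel)" and ab: "a\<^sup>2 + b\<^sup>2 = 1"
  shows "(\<integral>\<^sup>+x. \<integral>\<^sup>+w. \<psi> (a * x + b * w, b * x - a * w) \<partial>lborel \<partial>lborel)
    = (\<integral>\<^sup>+x. \<integral>\<^sup>+w. \<psi> (x, w) \<partial>lborel \<partial>lborel)"
proof (cases "b = 0")
  case True
  then have a: "a = 1 \<or> a = -1" using ab by (simp add: power2_eq_1_iff)
  have *: "(\<integral>\<^sup>+x. f x \<partial>lborel) = (\<integral>\<^sup>+x. f (a * x) \<partial>lborel)" "(\<integral>\<^sup>+x. f x \<partial>lborel) = (\<integral>\<^sup>+x. f (- (a * x)) \<partial>lborel)"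
    if "f \<in> borel_measurable borel" for f :: "real \<Rightarrow> ennreal"
    by (subst nn_integral_real_affine[OF that, of a 0]; use a in force)
      (subst nn_integral_real_affine[OF that, of "- a" 0]; use a in force)
  have "(\<integral>\<^sup>+x. \<integral>\<^sup>+w. \<psi> (a * x + b * w, b * x - a * w) \<partial>lborel \<partial>lborel)
      = (\<integral>\<^sup>+x. \<integral>\<^sup>+w. \<psi> (a * x, w) \<partial>lborel \<partial>lborel)"
  proof (rule nn_integral_cong)
    fix x show "(\<integral>\<^sup>+w. \<psi> (a * x + b * w, b * x - a * w) \<partial>lborel) = (\<integral>\<^sup>+w. \<psi> (a * x, w) \<partial>lborel)"
      using *(2)[of "\<lambda>w. \<psi> (a * x, w)"] True by simp
  qed
  also have "\<dots> = (\<integral>\<^sup>+x. \<integral>\<^sup>+w. \<psi> (x, w) \<partial>lborel \<partial>lborel)"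
    by (rule *(1)[symmetric]) measurable
  finally show ?thesis .
next
  case False
  have eq: "b * x - a * (- a * x / b + 1 / b * u) = (x - a * u) / b" for x u
  proof -
    have "b * x - a * (- a * x / b + 1 / b * u) = ((a\<^sup>2 + b\<^sup>2) * x - a * u) / b"
      using False by (simp add: field_simps power2_eq_square)
    then show ?thesis using ab by simp
  qed
  have eq': "a * x + b * (- a * x / b + 1 / b * u) = u" for x u
    using False by (simp add: field_simps)
  have "(\<integral>\<^sup>+x. \<integral>\<^sup>+w. \<psi> (a * x + b * w, b * x - a * w) \<partial>lborel \<partial>lborel)
    = (\<integral>\<^sup>+x. \<bar>1 / b\<bar> * (\<integral>\<^sup>+u. \<psi> (u, (x - a * u) / b) \<partial>lborel) \<partial>lborel)"
  proof (rule nn_integral_cong)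
    fix x
    show "(\<integral>\<^sup>+w. \<psi> (a * x + b * w, b * x - a * w) \<partial>lborel) = \<bar>1 / b\<bar> * (\<integral>\<^sup>+u. \<psi> (u, (x - a * u) / b) \<partial>lborel)"
      using nn_integral_real_affine[of "\<lambda>w. \<psi> (a * x + b * w, b * x - a * w)" "1 / b" "- a * x / b"] False
      unfolding eq eq' by simp
  qed
  also have "\<dots> = \<bar>1 / b\<bar> * (\<integral>\<^sup>+x. (\<integral>\<^sup>+u. \<psi> (u, (x - a * u) / b) \<partial>lborel) \<partial>lborel)"
    by (rule nn_integral_cmult) auto
  also have "(\<integral>\<^sup>+x. (\<integral>\<^sup>+u. \<psi> (u, (x - a * u) / b) \<partial>lborel) \<partial>lborel)
     = (\<integral>\<^sup>+u. (\<integral>\<^sup>+x. \<psi> (u, (x - a * u) / b) \<partial>lborel) \<partial>lborel)"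
    by (rule lborel_pair.Fubini') measurable
  also have "\<dots> = (\<integral>\<^sup>+u. \<bar>b\<bar> * (\<integral>\<^sup>+v. \<psi> (u, v) \<partial>lborel) \<partial>lborel)"
  proof (rule nn_integral_cong)
    fix u
    show "(\<integral>\<^sup>+x. \<psi> (u, (x - a * u) / b) \<partial>lborel) = \<bar>b\<bar> * (\<integral>\<^sup>+v. \<psi> (u, v) \<partial>lborel)"
      using nn_integral_real_affine[of "\<lambda>x. \<psi> (u, (x - a * u) / b)" b "a * u"] False by simp
  qed
  also have "\<dots> = \<bar>b\<bar> * (\<integral>\<^sup>+u. (\<integral>\<^sup>+v. \<psi> (u, v) \<partial>lborel) \<partial>lborel)"
    by (rule nn_integral_cmult) auto
  finally show ?thesis
    using False by (simp add: mult.assoc[symmetric] ennreal_mult'[symmetric])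
qed

text \<open>The matrix with rows (a, b) and (b, -a) is symmetric and orthogonal, hence its own
  inverse. This is the reason for the sign in b x - a w: the same formula leads back.\<close>

lemma rotate_inverse:
  fixes a b x w :: real
  assumes ab: "a\<^sup>2 + b\<^sup>2 = 1"
  shows "a * (a * x + b * w) + b * (b * x - a * w) = x"
    and "b * (a * x + b * w) - a * (b * x - a * w) = w"
proof -
  have "a * (a * x + b * w) + b * (b * x - a * w) = (a\<^sup>2 + b\<^sup>2) * x"
    "b * (a * x + b * w) - a * (b * x - a * w) = (a\<^sup>2 + b\<^sup>2) * w"
    by (simp_all add: power2_eq_square algebra_simps)
  then show "a * (a * x + b * w) + b * (b * x - a * w) = x"
    "b * (a * x + b * w) - a * (b * x - a * w) = w"
    by (simp_all add: ab)
qed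

lemma nn_integral_gauss1_rotate:
  fixes \<phi> :: "real \<times> real \<Rightarrow> ennreal"
  assumes [measurable]: "\<phi> \<in> borel_measurable (borel \<Otimes>\<^sub>M borel)" and ab: "a\<^sup>2 + b\<^sup>2 = 1"
  shows "(\<integral>\<^sup>+x. \<integral>\<^sup>+w. \<phi> (a * x + b * w, b * x - a * w) \<partial>gauss1 \<partial>gauss1)
    = (\<integral>\<^sup>+x. \<integral>\<^sup>+w. \<phi> (x, w) \<partial>gauss1 \<partial>gauss1)"
proof -
  define \<psi> where "\<psi> = (\<lambda>z. \<phi> z * ennreal (exp (- pi * ((fst z)\<^sup>2 + (snd z)\<^sup>2))))"
  have [measurable]: "\<psi> \<in> borel_measurable (borel \<Otimes>\<^sub>M borel)"
    unfolding \<psi>_def by measurable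
  have *: "(\<integral>\<^sup>+x. \<integral>\<^sup>+w. f x w \<partial>gauss1 \<partial>gauss1)
      = (\<integral>\<^sup>+x. \<integral>\<^sup>+w. f x w * ennreal (exp (- pi * (x\<^sup>2 + w\<^sup>2))) \<partial>lborel \<partial>lborel)"
    if [measurable]: "(\<lambda>(x, w). f x w) \<in> borel_measurable (borel \<Otimes>\<^sub>M borel)" for f :: "real \<Rightarrow> real \<Rightarrow> ennreal"
  proof -
    have "(\<integral>\<^sup>+x. \<integral>\<^sup>+w. f x w \<partial>gauss1 \<partial>gauss1)
      = (\<integral>\<^sup>+x. (\<integral>\<^sup>+w. f x w * ennreal (exp (- pi * w\<^sup>2)) \<partial>lborel) * ennreal (exp (- pi * x\<^sup>2)) \<partial>lborel)"
      by (simp add: nn_integral_gauss1)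
    also have "\<dots> = (\<integral>\<^sup>+x. (\<integral>\<^sup>+w. f x w * ennreal (exp (- pi * w\<^sup>2)) * ennreal (exp (- pi * x\<^sup>2)) \<partial>lborel) \<partial>lborel)"
      by (simp add: nn_integral_multc)
    also have "\<dots> = (\<integral>\<^sup>+x. \<integral>\<^sup>+w. f x w * ennreal (exp (- pi * (x\<^sup>2 + w\<^sup>2))) \<partial>lborel \<partial>lborel)"
      by (simp add: mult.assoc ennreal_mult'[symmetric] exp_add[symmetric] algebra_simps)
    finally show ?thesis .
  qed
  have sq: "(a * x + b * w)\<^sup>2 + (b * x - a * w)\<^sup>2 = x\<^sup>2 + w\<^sup>2" for x w
  proof -
    have "(a * x + b * w)\<^sup>2 + (b * x - a * w)\<^sup>2 = (a\<^sup>2 + b\<^sup>2) * (x\<^sup>2 + w\<^sup>2)"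
      by (simp add: power2_eq_square algebra_simps)
    then show ?thesis using ab by simp
  qed
  show ?thesis
    using nn_integral_lborel_rotate[OF \<open>\<psi> \<in> _\<close> ab]
    by (simp add: * \<psi>_def sq)
qed

lemma distr_gauss1_pair_rotate:
  assumes ab: "a\<^sup>2 + b\<^sup>2 = 1"
  shows "distr (gauss1 \<Otimes>\<^sub>M gauss1) (gauss1 \<Otimes>\<^sub>M gauss1) (\<lambda>(x, w). (a * x + b * w, b * x - a * w))
    = gauss1 \<Otimes>\<^sub>M gauss1" (is "distr ?G ?G ?r = ?G")
proof (rule measure_eqI)
  fix A assume "A \<in> sets (distr ?G ?G ?r)"
  then have A [measurable]: "A \<in> sets (gauss1 \<Otimes>\<^sub>M gauss1)" by simp
  have [measurable]: "A \<in> sets (borel \<Otimes>\<^sub>M borel)"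
    using A sets_pair_measure_cong[OF sets_gauss1 sets_gauss1] by simp
  have "emeasure (distr ?G ?G ?r) A = (\<integral>\<^sup>+z. indicator A z \<partial>distr ?G ?G ?r)"
    by (rule nn_integral_indicator[symmetric]) simp
  also have "\<dots> = (\<integral>\<^sup>+z. indicator A (?r z) \<partial>?G)"
    by (rule nn_integral_distr) measurable
  also have "\<dots> = (\<integral>\<^sup>+x. \<integral>\<^sup>+w. indicator A (a * x + b * w, b * x - a * w) \<partial>gauss1 \<partial>gauss1)"
    by (subst gauss1.nn_integral_fst[symmetric]) simp_all
  also have "\<dots> = (\<integral>\<^sup>+x. \<integral>\<^sup>+w. indicator A (x, w) \<partial>gauss1 \<partial>gauss1)"
    by (rule nn_integral_gauss1_rotate[OF _ ab]) measurable
  also have "\<dots> = emeasure ?G A"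
    by (subst gauss1.nn_integral_fst) simp_all
  finally show "emeasure (distr ?G ?G ?r) A = emeasure ?G A" .
qed simp

subsection \<open>Monotone transport on the line\<close>

text \<open>A continuous positive density makes the distribution function a C^1 bijection of the
  line onto (0, 1) with nonvanishing derivative, so its inverse is differentiable.\<close>

lemma density_cdf:
  fixes q :: "real \<Rightarrow> real"
  assumes cont: "continuous_on UNIV q" and pos: "\<And>x. 0 < q x" and one: "(\<integral>\<^sup>+x. q x \<partial>lborel) = 1"
  defines "M \<equiv> density lborel (\<lambda>x. ennreal (q x))"
  shows "real_distribution M"
    and "(cdf M has_real_derivative q t) (at t)"
    and "strict_mono (cdf M)"
    and "0 < cdf M t" "cdf M t < 1"
    and "0 < y \<Longrightarrow> y < 1 \<Longrightarrow> \<exists>t. cdf M t = y"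
proof -
  have [measurable]: "q \<in> borel_measurable borel"
    using cont by (rule borel_measurable_continuous_onI)
  have "prob_space M"
    unfolding M_def by (rule prob_spaceI) (simp add: emeasure_density one)
  then show M: "real_distribution M"
    unfolding real_distribution_def real_distribution_axioms_def by (simp add: M_def)
  interpret M: real_distribution M by (rule M)
  have diff: "cdf M t = cdf M a + integral {a..t} q" if "a \<le> t" for a t
  proof (cases "a = t")
    case False
    with that have "a < t" by simp
    have int: "set_integrable lborel {a..t} q"
      by (rule borel_integrable_atLeastAtMost') (use cont continuous_on_subset in blast)
    have "emeasure M {a<..t} = (\<integral>\<^sup>+x. ennreal (q x) * indicator {a<..t} x \<partial>lborel)"
      unfolding M_def by (simp add: emeasure_density)
    also have "\<dots> = (\<integral>\<^sup>+x. ennreal (indicator {a..t} x * q x) \<partial>lborel)"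
      by (rule nn_integral_cong_AE, rule AE_mp[OF AE_lborel_singleton[of a]])
         (auto split: split_indicator)
    also have "\<dots> = ennreal (\<integral>x. indicator {a..t} x * q x \<partial>lborel)"
      by (rule nn_integral_eq_integral)
        (use int pos in \<open>auto simp: set_integrable_def less_imp_le split: split_indicator\<close>)
    also have "(\<integral>x. indicator {a..t} x * q x \<partial>lborel) = integral {a..t} q"
      using set_borel_integral_eq_integral(2)[OF int] by (simp add: set_lebesgue_integral_def)
    finally have "measure M {a<..t} = integral {a..t} q"
      unfolding measure_def
      by (simp add: integral_nonneg pos less_imp_le integrable_continuous_interval continuous_on_subset[OF cont])
    then show ?thesis
      using M.cdf_diff_eq[OF \<open>a < t\<close>] by simp
  qed simp
  show deriv: "(cdf M has_real_derivative q t) (at t)" for t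
  proof -
    have "((\<lambda>x. integral {t - 1..x} q) has_real_derivative q t) (at t within {t - 1..t + 1})"
      by (rule integral_has_real_derivative) (auto intro: continuous_on_subset[OF cont])
    then have "((\<lambda>x. integral {t - 1..x} q) has_real_derivative q t) (at t)"
      by (subst (asm) at_within_interior) auto
    then have "((\<lambda>x. cdf M (t - 1) + integral {t - 1..x} q) has_real_derivative q t) (at t)"
      by (auto intro!: derivative_eq_intros)
    then show ?thesis
    proof (rule has_field_derivative_transform_within_open)
      show "open {t - 1 <..< t + 1}" "t \<in> {t - 1 <..< t + 1}" by auto
    qed (metis diff greaterThanLessThan_iff less_imp_le)
  qed
  show sm: "strict_mono (cdf M)"
    by (rule strict_monoI, erule DERIV_pos_imp_increasing) (rule exI, rule conjI[OF deriv pos])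
  show "0 < cdf M t"
    using sm M.cdf_nonneg[of "t - 1"] strict_monoD[OF sm, of "t - 1" t] by simp
  show "cdf M t < 1"
    using M.cdf_bounded_prob[of "t + 1"] strict_monoD[OF sm, of t "t + 1"] by simp
  show "\<exists>t. cdf M t = y" if y: "0 < y" "y < 1"
  proof -
    have "\<forall>\<^sub>F t in at_bot. cdf M t < y"
      using M.cdf_lim_at_bot y(1) by (rule order_tendstoD)
    then obtain l where l: "cdf M l < y"
      by (auto simp: eventually_at_bot_linorder)
    have "\<forall>\<^sub>F t in at_top. y < cdf M t"
      using M.cdf_lim_at_top_prob y(2) by (rule order_tendstoD)
    then obtain u where u: "y < cdf M u"
      by (auto simp: eventually_at_top_linorder)
    have "l \<le> u"
      using l u strict_mono_less[OF sm, of l u] by simp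
    moreover have "continuous_on {l..u} (cdf M)"
      by (meson DERIV_continuous_on deriv has_field_derivative_at_within)
    ultimately show ?thesis
      using IVT'[of "cdf M" l y u] l u by auto
  qed
qed

text \<open>\<open>T\<close> is the distribution function of the source followed by the inverse of
  that of the target. Differentiating \<open>cdf Q (T x) = cdf P x\<close> gives its
  derivative.\<close>

lemma monotone_transport:
  fixes p q :: "real \<Rightarrow> real"
  assumes p: "continuous_on UNIV p" "\<And>x. 0 < p x" "(\<integral>\<^sup>+x. p x \<partial>lborel) = 1"
    and q: "continuous_on UNIV q" "\<And>x. 0 < q x" "(\<integral>\<^sup>+x. q x \<partial>lborel) = 1"
  obtains T where "\<And>x. (T has_real_derivative p x / q (T x)) (at x)"
    and "distr (density lborel p) borel T = density lborel q"
proof -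
  define P where "P = density lborel (\<lambda>x. ennreal (p x))"
  define Q where "Q = density lborel (\<lambda>x. ennreal (q x))"
  note P = density_cdf[OF p, folded P_def]
  note Q = density_cdf[OF q, folded Q_def]
  interpret P: real_distribution P by (rule P(1))
  interpret Q: real_distribution Q by (rule Q(1))
  define G where "G = inv_into UNIV (cdf Q)"
  define T where "T x = G (cdf P x)" for x
  have G1: "G (cdf Q t) = t" for t
    unfolding G_def using strict_mono_imp_inj_on[OF Q(3)] by (rule inv_f_f)
  have G2: "cdf Q (G y) = y" if "0 < y" "y < 1" for y
    using Q(6)[OF that] unfolding G_def by (auto intro: f_inv_into_f)
  have T: "cdf Q (T x) = cdf P x" for x
    unfolding T_def by (rule G2) (rule P)+
  have contG: "isCont G (cdf Q t)" for t
    by (rule isCont_inverse_function[of 1]) (auto simp: G1 intro: DERIV_isCont[OF Q(2)])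
  have "(T has_real_derivative p x / q (T x)) (at x)" for x
  proof -
    have "(G has_real_derivative inverse (q (T x))) (at (cdf P x))"
    proof (rule DERIV_inverse_function[where f = "cdf Q" and a = 0 and b = 1])
      show "(cdf Q has_real_derivative q (T x)) (at (G (cdf P x)))"
        unfolding T_def[symmetric] by (rule Q(2))
      show "q (T x) \<noteq> 0" using q(2)[of "T x"] by simp
      show "isCont G (cdf P x)"
        using contG[of "T x"] by (simp add: T)
    qed (use P(4,5) G2 in auto)
    from DERIV_chain2[OF this P(2)] show ?thesis
      unfolding T_def by (simp add: field_simps)
  qed
  moreover have "distr P borel T = Q"
  proof (rule cdf_unique)
    have T_meas: "T \<in> borel_measurable borel"
      by (rule borel_measurable_continuous_onI, rule continuous_at_imp_continuous_on)
        (use calculation DERIV_isCont in blast)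
    then have [measurable]: "T \<in> borel_measurable P" by simp
    show "real_distribution (distr P borel T)"
      by (rule P.real_distribution_distr) measurable
    show "real_distribution Q" by (rule Q(1))
    show "cdf (distr P borel T) = cdf Q"
    proof
      fix t
      obtain x where x: "cdf P x = cdf Q t"
        using P(6)[OF Q(4,5)] by blast
      then have "t = T x" by (simp add: T_def G1)
      \<comment> \<open>Preimages of half-lines under \<open>T\<close> are half-lines, so the image
        measure is identified by its distribution function.\<close>
      have "T u \<le> t \<longleftrightarrow> u \<le> x" for u
        unfolding \<open>t = T x\<close>
        using strict_mono_less_eq[OF Q(3), of "T u" "T x"] strict_mono_less_eq[OF P(3), of u x]
        by (simp add: T)
      then have "T -` {..t} \<inter> space P = {..x}" by auto
      then have "cdf (distr P borel T) t = cdf P x"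
        unfolding cdf_def by (subst measure_distr) simp_all
      then show "cdf (distr P borel T) t = cdf Q t"
        using x by (rule trans)
    qed
  qed
  ultimately show thesis
    using that unfolding P_def Q_def by blast
qed

text \<open>The substitution is exact on each interval [-n, n], whose image is [R(-n), R(n)]. Only
  an inequality survives in the limit because \<open>R\<close> need not be onto; the Gibbs step uses
  just this upper bound.\<close>

lemma nn_integral_substitution_le:
  fixes g R R' :: "real \<Rightarrow> real"
  assumes [measurable]: "g \<in> borel_measurable borel" and g: "\<And>x. 0 \<le> g x"
    and R: "\<And>x. (R has_real_derivative R' x) (at x)"
    and R': "continuous_on UNIV R'" "\<And>x. 0 \<le> R' x"
  shows "(\<integral>\<^sup>+x. ennreal (g (R x) * R' x) \<partial>lborel) \<le> (\<integral>\<^sup>+x. ennreal (g x) \<partial>lborel)"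
proof -
  have [measurable]: "R' \<in> borel_measurable borel" "R \<in> borel_measurable borel"
    using R'(1) by (auto intro!: borel_measurable_continuous_onI continuous_at_imp_continuous_on DERIV_isCont R)
  let ?h = "\<lambda>n x. ennreal (g (R x) * R' x) * indicator {- real n..real n} x"
  have "(\<integral>\<^sup>+x. ?h n x \<partial>lborel) \<le> (\<integral>\<^sup>+x. ennreal (g x) \<partial>lborel)" for n
  proof -
    have "(\<integral>\<^sup>+x. ?h n x \<partial>lborel) = (\<integral>\<^sup>+x. ennreal (g (R x) * R' x * indicator {- real n..real n} x) \<partial>lborel)"
      by (rule nn_integral_cong) (auto split: split_indicator)
    also have "\<dots> = (\<integral>\<^sup>+x. ennreal (g x * indicator {R (- real n)..R (real n)} x) \<partial>lborel)"
    proof (rule nn_integral_substitution[symmetric])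
      show "set_borel_measurable borel {R (- real n)..R (real n)} g"
        unfolding set_borel_measurable_def by measurable
      show "continuous_on {- real n..real n} R'"
        using R'(1) by (rule continuous_on_subset) simp
    qed (use R R' in auto)
    also have "\<dots> \<le> (\<integral>\<^sup>+x. ennreal (g x) \<partial>lborel)"
      by (rule nn_integral_mono) (auto split: split_indicator simp: g)
    finally show ?thesis .
  qed
  moreover have "(\<integral>\<^sup>+x. ennreal (g (R x) * R' x) \<partial>lborel) = (SUP n. \<integral>\<^sup>+x. ?h n x \<partial>lborel)"
  proof (subst nn_integral_monotone_convergence_SUP[symmetric])
    show "incseq ?h"
      by (auto simp: incseq_def le_fun_def split: split_indicator)
    show "(\<integral>\<^sup>+x. ennreal (g (R x) * R' x) \<partial>lborel) = (\<integral>\<^sup>+x. (SUP n. ?h n x) \<partial>lborel)"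
    proof (rule nn_integral_cong)
      fix x :: real
      obtain n :: nat where n: "\<bar>x\<bar> \<le> real n" using real_arch_simple by blast
      show "ennreal (g (R x) * R' x) = (SUP n. ?h n x)"
      proof (rule antisym)
        have "ennreal (g (R x) * R' x) = ?h n x"
          using n by (auto simp: abs_le_iff indicator_def)
        also have "\<dots> \<le> (SUP n. ?h n x)" by (rule SUP_upper) simp
        finally show "ennreal (g (R x) * R' x) \<le> (SUP n. ?h n x)" .
      qed (auto intro!: SUP_least split: split_indicator)
    qed
  qed measurable
  ultimately show ?thesis
    by (simp add: SUP_least)
qed

subsection \<open>The one-dimensional entropy inequality\<close>

lemma integrable_gauss1_bounded:
  fixes f :: "real \<Rightarrow> real"
  assumes "f \<in> borel_measurable borel" "\<And>x. \<bar>f x\<bar> \<le> B"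
  shows "integrable gauss1 f"
  by (rule gauss1.integrable_const_bound[of _ B]) (use assms in auto)

lemma integrable_gauss1_pair_bounded:
  fixes f :: "real \<times> real \<Rightarrow> real"
  assumes "f \<in> borel_measurable (borel \<Otimes>\<^sub>M borel)" "\<And>x. \<bar>f x\<bar> \<le> B"
  shows "integrable (gauss1 \<Otimes>\<^sub>M gauss1) f"
  by (rule gauss1_pair.integrable_const_bound[of _ B])
    (use assms in \<open>auto simp: measurable_cong_sets[OF sets_pair_measure_cong[OF sets_gauss1 sets_gauss1] refl]\<close>)

lemma abs_ln_le:
  fixes t :: real
  assumes "0 < c" "c \<le> t" "t \<le> C"
  shows "\<bar>ln t\<bar> \<le> \<bar>ln c\<bar> + \<bar>ln C\<bar>"
proof -
  have "ln c \<le> ln t" "ln t \<le> ln C" using assms by auto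
  then show ?thesis by linarith
qed

text \<open>Concavity of ln between t and 1; the term with weight b^2 disappears because ln 1 =
  0.\<close>

lemma ln_convex_combination_ge:
  fixes a b t :: real
  assumes "a\<^sup>2 + b\<^sup>2 = 1" "0 < t"
  shows "0 < a\<^sup>2 * t + b\<^sup>2" "a\<^sup>2 * ln t \<le> ln (a\<^sup>2 * t + b\<^sup>2)"
proof -
  have b: "b\<^sup>2 = 1 - a\<^sup>2" "0 \<le> b\<^sup>2" "b\<^sup>2 \<le> 1" using assms(1) by (auto simp: algebra_simps) (metis add_increasing zero_le_power2 order_refl)
  have a: "a\<^sup>2 = 1 - b\<^sup>2" using assms(1) by simp
  show "0 < a\<^sup>2 * t + b\<^sup>2"
    using assms by (cases "a = 0") (auto intro: add_pos_nonneg)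
  show "a\<^sup>2 * ln t \<le> ln (a\<^sup>2 * t + b\<^sup>2)"
    using concave_onD[OF ln_concave, of "b\<^sup>2" t 1] b assms(2) unfolding a by simp
qed

text \<open>For 0 < a <= 1 and a^2 + b^2 = 1 this is the Ornstein-Uhlenbeck semigroup at time - ln
  a.\<close>

definition mehler :: "real \<Rightarrow> real \<Rightarrow> (real \<Rightarrow> real) \<Rightarrow> real \<Rightarrow> real" where
  "mehler a b f v = (\<integral>w. f (a * v + b * w) \<partial>gauss1)"

lemma borel_measurable_mehler [measurable]:
  assumes [measurable]: "f \<in> borel_measurable borel"
  shows "mehler a b f \<in> borel_measurable borel"
  unfolding mehler_def by measurable

lemma mehler_bounds:
  assumes [measurable]: "f \<in> borel_measurable borel" and "\<And>x. c \<le> f x" "\<And>x. f x \<le> C"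
  shows "c \<le> mehler a b f v" "mehler a b f v \<le> C"
proof -
  have "\<bar>f x\<bar> \<le> \<bar>c\<bar> + \<bar>C\<bar>" for x
    using assms(2,3)[of x] by linarith
  then have int: "integrable gauss1 (\<lambda>w. f (a * v + b * w))"
    by (intro integrable_gauss1_bounded) auto
  show "c \<le> mehler a b f v" "mehler a b f v \<le> C"
    unfolding mehler_def
    by (rule gauss1.integral_ge_const[OF int], use assms in simp)
      (rule gauss1.integral_le_const[OF int], use assms in simp)
qed

lemma integral_gauss1_pair_rotate:
  fixes \<phi> :: "real \<times> real \<Rightarrow> real"
  assumes [measurable]: "\<phi> \<in> borel_measurable (borel \<Otimes>\<^sub>M borel)" and ab: "a\<^sup>2 + b\<^sup>2 = 1"
  shows "(\<integral>(x, w). \<phi> (a * x + b * w, b * x - a * w) \<partial>(gauss1 \<Otimes>\<^sub>M gauss1)) = (\<integral>z. \<phi> z \<partial>(gauss1 \<Otimes>\<^sub>M gauss1))"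
  by (subst (2) distr_gauss1_pair_rotate[OF ab, symmetric], subst integral_distr)
    (auto simp: split_beta')

text \<open>Self-adjointness of the Mehler operator: the rotation makes a v + b w the new first
  coordinate x, and v becomes a x + b w. For \<psi> = 1 it says that the mean is preserved.\<close>

lemma integral_mehler:
  assumes [measurable]: "f \<in> borel_measurable borel" "\<psi> \<in> borel_measurable borel"
    and f_le: "\<And>x. \<bar>f x\<bar> \<le> B" and psi_le: "\<And>x. \<bar>\<psi> x\<bar> \<le> K" and ab: "a\<^sup>2 + b\<^sup>2 = 1"
  shows "(\<integral>v. mehler a b f v * \<psi> v \<partial>gauss1) = (\<integral>w. (\<integral>x. f x * \<psi> (a * x + b * w) \<partial>gauss1) \<partial>gauss1)"
proof -
  have bd: "\<bar>f x * \<psi> y\<bar> \<le> B * K" for x y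
    using mult_mono[OF f_le[of x] psi_le[of y]] f_le[of x] by (simp add: abs_mult)
  have int: "integrable (gauss1 \<Otimes>\<^sub>M gauss1) (\<lambda>(v, w). f (a * v + b * w) * \<psi> v)"
     "integrable (gauss1 \<Otimes>\<^sub>M gauss1) (\<lambda>(x, w). f x * \<psi> (a * x + b * w))"
    by (rule integrable_gauss1_pair_bounded[of _ "B * K"]; use bd in \<open>auto simp: split_beta'\<close>)+
  have "(\<integral>v. mehler a b f v * \<psi> v \<partial>gauss1) = (\<integral>v. (\<integral>w. f (a * v + b * w) * \<psi> v \<partial>gauss1) \<partial>gauss1)"
    by (simp add: mehler_def)
  also have "\<dots> = (\<integral>(v, w). f (a * v + b * w) * \<psi> v \<partial>(gauss1 \<Otimes>\<^sub>M gauss1))"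
    using gauss1_pair.integral_fst'[OF int(1)] by simp
  also have "\<dots> = (\<integral>(x, w). f x * \<psi> (a * x + b * w) \<partial>(gauss1 \<Otimes>\<^sub>M gauss1))"
    by (subst integral_gauss1_pair_rotate[OF _ ab, symmetric]) (auto simp: rotate_inverse(1)[OF ab] split_beta')
  also have "\<dots> = (\<integral>w. (\<integral>x. f x * \<psi> (a * x + b * w) \<partial>gauss1) \<partial>gauss1)"
    by (rule gauss1_pair.integral_snd[OF int(2), symmetric])
  finally show ?thesis .
qed

text \<open>Mass 1 makes f times the Gaussian density a probability density, to which the Gaussian
  can be transported, and makes m ln m vanish. The bounds on f keep ln f and ln (P f)
  bounded.\<close>

lemma entropy_mehler_continuous_normalized:
  fixes f :: "real \<Rightarrow> real"
  assumes cont: "continuous_on UNIV f" and c: "0 < c" "\<And>x. c \<le> f x" and C: "\<And>x. f x \<le> C"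
    and one: "(\<integral>x. f x \<partial>gauss1) = 1" and ab: "a\<^sup>2 + b\<^sup>2 = 1"
  shows "(\<integral>v. mehler a b f v * ln (mehler a b f v) \<partial>gauss1) \<le> a\<^sup>2 * (\<integral>x. f x * ln (f x) \<partial>gauss1)"
proof -
  let ?G = "gauss1 \<Otimes>\<^sub>M gauss1"
  define p where "p = (\<lambda>x::real. exp (- pi * x\<^sup>2))"
  define F where "F = mehler a b f"
  have [measurable]: "f \<in> borel_measurable borel"
    using cont by (rule borel_measurable_continuous_onI)
  have F_meas [measurable]: "F \<in> borel_measurable borel"
    unfolding F_def by measurable
  have F: "c \<le> F v" "F v \<le> C" "0 < F v" for v
    using mehler_bounds[of f c C a b v] c C unfolding F_def by auto
  have f_pos: "0 < f x" for x using c(2)[of x] c(1) by simp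
  have p_pos: "0 < p x" for x by (simp add: p_def)
  have [measurable]: "p \<in> borel_measurable borel" unfolding p_def by measurable
  define K where "K = \<bar>ln c\<bar> + \<bar>ln C\<bar>"
  have K: "\<bar>ln t\<bar> \<le> K" if "c \<le> t" "t \<le> C" for t
    unfolding K_def using c(1) that by (rule abs_ln_le)
  have fb: "\<bar>f x\<bar> \<le> C" for x using f_pos[of x] C[of x] by simp
  have f_int: "integrable gauss1 f" by (rule integrable_gauss1_bounded[OF _ fb]) measurable
  have f_nn: "(\<integral>\<^sup>+x. f x \<partial>gauss1) = 1"
    using nn_integral_eq_integral[OF f_int] f_pos one by (simp add: less_imp_le)
  have p_cont: "continuous_on UNIV p" unfolding p_def by (intro continuous_intros)
  have p_one: "(\<integral>\<^sup>+x. p x \<partial>lborel) = 1"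
    using gauss1.emeasure_space_1 unfolding gauss1_def p_def by (simp add: emeasure_density)
  define q where "q = (\<lambda>x. f x * p x)"
  have q: "continuous_on UNIV q" "\<And>x. 0 < q x"
    unfolding q_def using cont p_cont f_pos p_pos by (auto intro!: continuous_intros)
  have q_one: "(\<integral>\<^sup>+x. q x \<partial>lborel) = 1"
    using f_nn unfolding q_def by (subst (asm) nn_integral_gauss1) (auto simp: p_def ennreal_mult' f_pos less_imp_le)
  obtain T where T': "\<And>x. (T has_real_derivative p x / q (T x)) (at x)"
    and distr: "distr (density lborel p) borel T = density lborel q"
    using monotone_transport[OF p_cont p_pos p_one q q_one] by blast
  have T_cont: "continuous_on UNIV T"
    by (rule continuous_at_imp_continuous_on) (use T' DERIV_isCont in blast)
  then have [measurable]: "T \<in> borel_measurable borel"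
    by (rule borel_measurable_continuous_onI)
  have p_gauss: "density lborel (\<lambda>x. ennreal (p x)) = gauss1"
    by (simp add: gauss1_def p_def)
  have q_gauss: "density lborel (\<lambda>x. ennreal (q x)) = density gauss1 f"
    unfolding gauss1_def q_def p_def
    by (subst density_density_eq) (auto simp: ennreal_mult' f_pos less_imp_le mult.commute)
  have distr: "distr gauss1 borel T = density gauss1 f"
    using distr unfolding p_gauss q_gauss .
  have push: "(\<integral>x. f x * \<psi> x \<partial>gauss1) = (\<integral>x. \<psi> (T x) \<partial>gauss1)"
    if [measurable]: "\<psi> \<in> borel_measurable borel" for \<psi> :: "real \<Rightarrow> real"
  proof -
    have "(\<integral>x. f x * \<psi> x \<partial>gauss1) = (\<integral>x. \<psi> x \<partial>density gauss1 f)"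
      by (subst integral_density) (auto simp: f_pos less_imp_le)
    then show ?thesis unfolding distr[symmetric] by (subst (asm) integral_distr) auto
  qed
  define T1 where "T1 x = p x / q (T x)" for x
  have T1_cont: "continuous_on UNIV T1"
    unfolding T1_def using q p_cont T_cont
    by (intro continuous_intros continuous_on_compose2[of UNIV q UNIV T]) (auto simp: less_imp_neq[symmetric])
  then have [measurable]: "T1 \<in> borel_measurable borel"
    by (rule borel_measurable_continuous_onI)
  have T1_pos: "0 < T1 x" for x unfolding T1_def using p_pos q(2) by simp
  \<comment> \<open>Needed for the cross term. The transport turns \<open>T\<close> into the
    identity weighted by \<open>f\<close>, which \<open>C * x\<close> dominates.\<close>
  have T_int: "integrable gauss1 T"
  proof -
    have le: "norm (f x * x) \<le> norm (C * x)" for x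
      using fb[of x] by (simp add: abs_mult mult_right_mono)
    have "integrable gauss1 (\<lambda>x. f x * x)"
      by (rule Bochner_Integration.integrable_bound[OF integrable_mult_right[OF integrable_gauss1_id, of C]])
        (measurable, intro AE_I2 le)
    then have "integrable (density gauss1 f) (\<lambda>x. x)"
      by (subst integrable_density) (auto simp: f_pos less_imp_le)
    then show ?thesis
      unfolding distr[symmetric] by (subst (asm) integrable_distr_eq) auto
  qed

  \<comment> \<open>Self-adjointness with \<psi> = ln F moves the weight onto f(x); transporting x
    to T(x) then absorbs it.\<close>
  have step1: "(\<integral>v. F v * ln (F v) \<partial>gauss1) = (\<integral>(x, w). ln (F (a * T x + b * w)) \<partial>?G)"
  proof -
    have "(\<integral>v. F v * ln (F v) \<partial>gauss1) = (\<integral>w. (\<integral>x. f x * ln (F (a * x + b * w)) \<partial>gauss1) \<partial>gauss1)"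
      unfolding F_def by (rule integral_mehler[OF _ _ fb _ ab, where K = K]) (use K F in \<open>auto simp: F_def[symmetric]\<close>)
    also have "\<dots> = (\<integral>w. (\<integral>x. ln (F (a * T x + b * w)) \<partial>gauss1) \<partial>gauss1)"
      by (simp add: push[of "\<lambda>x. ln (F (a * x + b * _))"])
    also have "\<dots> = (\<integral>(x, w). ln (F (a * T x + b * w)) \<partial>?G)"
      by (rule gauss1_pair.integral_snd) (rule integrable_gauss1_pair_bounded[of _ K], use K F in auto)
    finally show ?thesis .
  qed
  \<comment> \<open>The integrand of the substitution y -> R relative to the Gaussian in y:
    \<open>F\<close> at the image, the derivative a^2 T' + b^2, and the ratio of the Gaussian
    densities at R and y.\<close>
  define k where "k = (\<lambda>(x, w). F (a * T x + b * w) * (a\<^sup>2 * T1 x + b\<^sup>2) * (p (a * T x + b * w) / p (a * x + b * w)))"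
  have [measurable]: "k \<in> borel_measurable (borel \<Otimes>\<^sub>M borel)"
    unfolding k_def by measurable
  have k_nonneg: "0 \<le> k z" for z
    unfolding k_def using F(3) p_pos ln_convex_combination_ge(1)[OF ab T1_pos]
    by (auto simp: split_beta' intro!: mult_nonneg_nonneg divide_nonneg_nonneg less_imp_le)
  \<comment> \<open>The bound ln k <= k - 1 is Gibbs' inequality in pointwise form; after
    integration \<open>k - 1\<close> contributes at most 0.\<close>
  have pointwise: "ln (F (a * T x + b * w)) \<le> k (x, w) - 1 + a\<^sup>2 * ln (f (T x)) + 2 * pi * a * b * (w * (T x - x))" for x w
  proof -
    let ?R = "a * T x + b * w" let ?y = "a * x + b * w"
    have pos: "0 < F ?R" "0 < a\<^sup>2 * T1 x + b\<^sup>2" "0 < p ?R / p ?y"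
      using F(3) p_pos ln_convex_combination_ge(1)[OF ab T1_pos] by auto
    have "ln (k (x, w)) = ln (F ?R) + ln (a\<^sup>2 * T1 x + b\<^sup>2) + ln (p ?R / p ?y)"
      using pos by (simp only: k_def prod.case ln_mult_pos mult_pos_pos)
    also have "ln (p ?R / p ?y) = pi * ?y\<^sup>2 - pi * ?R\<^sup>2"
      using p_pos by (simp add: ln_div p_def)
    finally have "ln (F ?R) = ln (k (x, w)) - ln (a\<^sup>2 * T1 x + b\<^sup>2) - pi * ?y\<^sup>2 + pi * ?R\<^sup>2" by simp
    moreover have "ln (k (x, w)) \<le> k (x, w) - 1"
      by (rule ln_le_minus_one) (use pos in \<open>simp only: k_def prod.case mult_pos_pos\<close>)
    moreover have "a\<^sup>2 * ln (T1 x) \<le> ln (a\<^sup>2 * T1 x + b\<^sup>2)"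
      by (rule ln_convex_combination_ge(2)[OF ab T1_pos])
    moreover have "ln (T1 x) = - pi * x\<^sup>2 + pi * (T x)\<^sup>2 - ln (f (T x))"
      unfolding T1_def q_def using f_pos[of "T x"] p_pos[of x] p_pos[of "T x"] by (simp add: ln_div ln_mult_pos) (simp add: p_def)
    ultimately have "ln (F ?R) \<le> k (x, w) - 1 - a\<^sup>2 * (- pi * x\<^sup>2 + pi * (T x)\<^sup>2 - ln (f (T x))) - pi * ?y\<^sup>2 + pi * ?R\<^sup>2"
      by simp
    also have "\<dots> = k (x, w) - 1 + a\<^sup>2 * ln (f (T x)) + 2 * pi * a * b * (w * (T x - x))"
      by (simp add: power2_eq_square algebra_simps)
    finally show ?thesis .
  qed
  have F_nn: "(\<integral>\<^sup>+v. F v \<partial>gauss1) = 1"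
  proof -
    have Fb: "\<bar>F v\<bar> \<le> C" for v using F[of v] by simp
    have int: "integrable gauss1 F" by (rule integrable_gauss1_bounded[OF _ Fb]) measurable
    have "(\<integral>v. F v * 1 \<partial>gauss1) = 1"
      unfolding F_def by (subst integral_mehler[OF _ _ fb _ ab, where K = 1]) (auto simp: one)
    then show ?thesis
      using nn_integral_eq_integral[OF int] F(3) by (simp add: less_imp_le)
  qed
  have k_nn: "(\<integral>\<^sup>+z. k z \<partial>?G) \<le> 1"
  proof -
    \<comment> \<open>\<open>R\<close> and its derivative \<open>R1\<close> in y, written in the
      rotated coordinates: x = a y + b z and w = b y - a z, with z held fixed.\<close>
    define R where "R z y = a * T (a * y + b * z) + b * (b * y - a * z)" for y z
    define R1 where "R1 z y = a\<^sup>2 * T1 (a * y + b * z) + b\<^sup>2" for y z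
    define \<phi> where "\<phi> = (\<lambda>(y, z). ennreal (F (R z y) * R1 z y * (p (R z y) / p y)))"
    have [measurable]: "\<phi> \<in> borel_measurable (borel \<Otimes>\<^sub>M borel)"
      unfolding \<phi>_def R_def R1_def by measurable
    have "(\<integral>\<^sup>+z. k z \<partial>?G) = (\<integral>\<^sup>+x. \<integral>\<^sup>+w. k (x, w) \<partial>gauss1 \<partial>gauss1)"
      by (subst gauss1.nn_integral_fst) (auto simp: split_beta')
    also have "\<dots> = (\<integral>\<^sup>+x. \<integral>\<^sup>+w. \<phi> (a * x + b * w, b * x - a * w) \<partial>gauss1 \<partial>gauss1)"
      by (simp add: \<phi>_def R_def R1_def k_def rotate_inverse[OF ab])
    also have "\<dots> = (\<integral>\<^sup>+y. \<integral>\<^sup>+z. \<phi> (y, z) \<partial>gauss1 \<partial>gauss1)"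
      by (rule nn_integral_gauss1_rotate[OF _ ab]) measurable
    also have "\<dots> = (\<integral>\<^sup>+z. \<integral>\<^sup>+y. \<phi> (y, z) \<partial>gauss1 \<partial>gauss1)"
      by (rule gauss1_pair.Fubini'[symmetric]) simp
    also have "\<dots> \<le> (\<integral>\<^sup>+z. 1 \<partial>gauss1)"
    proof (rule nn_integral_mono)
      fix z
      have [measurable]: "R z \<in> borel_measurable borel" "R1 z \<in> borel_measurable borel"
        unfolding R_def R1_def by measurable
      have R1_pos: "0 < R1 z y" for y
        unfolding R1_def by (rule ln_convex_combination_ge(1)[OF ab T1_pos])
      have "(\<integral>\<^sup>+y. \<phi> (y, z) \<partial>gauss1) = (\<integral>\<^sup>+y. \<phi> (y, z) * ennreal (p y) \<partial>lborel)"
        unfolding p_def by (rule nn_integral_gauss1) measurable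
      also have "\<dots> = (\<integral>\<^sup>+y. ennreal (F (R z y) * p (R z y) * R1 z y) \<partial>lborel)"
      proof (rule nn_integral_cong)
        fix y
        show "\<phi> (y, z) * ennreal (p y) = ennreal (F (R z y) * p (R z y) * R1 z y)"
          unfolding \<phi>_def using F(3)[of "R z y"] R1_pos[of y] p_pos[of y] p_pos[of "R z y"]
          by (simp add: ennreal_mult''[symmetric] less_imp_le field_simps)
      qed
      also have "\<dots> \<le> (\<integral>\<^sup>+u. ennreal (F u * p u) \<partial>lborel)"
      proof (rule nn_integral_substitution_le[where g = "\<lambda>u. F u * p u"])
        show "continuous_on UNIV (R1 z)"
          unfolding R1_def by (intro continuous_intros continuous_on_compose2[OF T1_cont]) auto
        show "(R z has_real_derivative R1 z y) (at y)" for y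
        proof -
          have "((\<lambda>y. T (a * y + b * z)) has_real_derivative T1 (a * y + b * z) * a) (at y)"
            by (rule DERIV_chain2[OF T'[folded T1_def]]) (auto intro!: derivative_eq_intros)
          then show ?thesis
            unfolding R_def R1_def
            by (auto intro!: derivative_eq_intros simp: power2_eq_square)
        qed
      qed (use F(3) p_pos R1_pos in \<open>auto intro!: mult_nonneg_nonneg simp: less_imp_le\<close>)
      also have "\<dots> = (\<integral>\<^sup>+u. F u \<partial>gauss1)"
        by (subst nn_integral_gauss1) (auto simp: p_def ennreal_mult' F(3) less_imp_le)
      finally show "(\<integral>\<^sup>+y. \<phi> (y, z) \<partial>gauss1) \<le> 1"
        using F_nn by simp
    qed
    finally show ?thesis by simp
  qed
  have k_int: "integrable ?G k"
    by (rule integrableI_bounded)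
      (use k_nn k_nonneg in \<open>auto simp: abs_of_nonneg intro: le_less_trans\<close>)
  have k_le: "(\<integral>z. k z \<partial>?G) \<le> 1"
    using nn_integral_eq_integral[OF k_int] k_nonneg k_nn by simp
  let ?L = "\<lambda>(x, w). ln (f (T x)) :: real" and ?W = "\<lambda>(x, w). w * (T x - x)"
  have L_int: "integrable ?G ?L"
    by (rule integrable_gauss1_pair_bounded[of _ K]) (use K c C in auto)
  have L: "(\<integral>z. ?L z \<partial>?G) = (\<integral>x. f x * ln (f x) \<partial>gauss1)"
    by (subst gauss1_pair.integral_fst'[symmetric]) (use L_int in \<open>auto simp: push\<close>)
  have TI: "integrable gauss1 (\<lambda>x. T x - x)"
    using T_int integrable_gauss1_id by simp
  have W_int: "integrable ?G ?W"
  proof (rule gauss1_pair.Fubini_integrable)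
    show "integrable gauss1 (\<lambda>x. \<integral>w. norm (?W (x, w)) \<partial>gauss1)"
      using TI integrable_gauss1_id by (simp add: abs_mult)
    show "AE x in gauss1. integrable gauss1 (\<lambda>w. ?W (x, w))"
      using integrable_gauss1_id by simp
  qed measurable
  \<comment> \<open>The inner integral runs over w and is a multiple of the mean of the
    Gaussian.\<close>
  have W: "(\<integral>z. ?W z \<partial>?G) = 0"
    by (subst gauss1_pair.integral_fst'[symmetric]) (use W_int in \<open>auto simp: integral_gauss1_id\<close>)
  have "(\<integral>(x, w). ln (F (a * T x + b * w)) \<partial>?G) \<le> (\<integral>z. k z - 1 + a\<^sup>2 * ?L z + 2 * pi * a * b * ?W z \<partial>?G)"
  proof (rule integral_mono)
    show "integrable ?G (\<lambda>(x, w). ln (F (a * T x + b * w)))"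
      by (rule integrable_gauss1_pair_bounded[of _ K]) (use K F in auto)
    show "integrable ?G (\<lambda>z. k z - 1 + a\<^sup>2 * ?L z + 2 * pi * a * b * ?W z)"
      using k_int L_int W_int by (intro Bochner_Integration.integrable_add Bochner_Integration.integrable_diff
        integrable_mult_right gauss1_pair.integrable_const)
  qed (use pointwise in auto)
  also have "\<dots> = (\<integral>z. k z \<partial>?G) - 1 + a\<^sup>2 * (\<integral>z. ?L z \<partial>?G) + 2 * pi * a * b * (\<integral>z. ?W z \<partial>?G)"
    using k_int L_int W_int gauss1_pair.prob_space
    by (simp add: Bochner_Integration.integral_add Bochner_Integration.integral_diff del: integral_mult_right_zero)
  also have "\<dots> \<le> a\<^sup>2 * (\<integral>x. f x * ln (f x) \<partial>gauss1)"
    unfolding L W using k_le by simp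
  finally show ?thesis
    using step1 unfolding F_def by simp
qed

section \<open>Removal of normalization, continuity and boundedness in one dimension\<close>

lemma x_ln_x_ge:
  fixes x :: real
  assumes "0 \<le> x"
  shows "x - 1 \<le> x * ln x"
proof (cases "x = 0")
  case False
  with assms have x: "0 < x" by simp
  then have "ln (1 / x) \<le> 1 / x - 1"
    by (intro ln_le_minus_one) simp
  then have "x * (1 - 1 / x) \<le> x * ln x"
    using x by (intro mult_left_mono) (simp_all add: ln_div)
  then show ?thesis
    using x by (simp add: right_diff_distrib)
qed simp

text \<open>The bound tends to 0 with x, which gives continuity at 0. For the negative part put s =
  sqrt x: - x ln x = 2 s^2 ln (1/s) <= 2 s.\<close>

lemma abs_x_ln_x_le:
  fixes x :: real
  assumes "0 \<le> x"
  shows "\<bar>x * ln x\<bar> \<le> 2 * sqrt x + x\<^sup>2"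
proof (cases "x = 0")
  case False
  with assms have x: "0 < x" by simp
  have "ln x \<le> x - 1" by (rule ln_le_minus_one[OF x])
  then have "x * ln x \<le> x * (x - 1)" using x by (intro mult_left_mono) auto
  also have "\<dots> \<le> x\<^sup>2" using x by (simp add: power2_eq_square right_diff_distrib)
  finally have up: "x * ln x \<le> x\<^sup>2" .
  define s where "s = sqrt x"
  have s: "0 < s" "x = s * s" using x by (simp_all add: s_def)
  have "ln s = - ln (1 / s)" using s(1) by (simp add: ln_div)
  moreover have "ln (1 / s) \<le> 1 / s - 1" using s(1) by (intro ln_le_minus_one) simp
  ultimately have "- ln s \<le> 1 / s" by simp
  then have "s * s * (- ln s) \<le> s * s * (1 / s)"
    using s(1) by (intro mult_left_mono) auto
  then have "- (x * ln x) \<le> 2 * s"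
    using s by (simp add: ln_mult_pos)
  moreover have "0 \<le> sqrt x" using x by simp
  ultimately show ?thesis
    using up unfolding s_def by (intro abs_leI) (auto intro: order_trans add_increasing)
qed simp

lemma abs_x_ln_x_le_const:
  fixes t :: real
  assumes "0 < c" "c \<le> t" "t \<le> C"
  shows "\<bar>t * ln t\<bar> \<le> C * (\<bar>ln c\<bar> + \<bar>ln C\<bar>)"
  unfolding abs_mult using assms by (intro mult_mono abs_ln_le) auto

text \<open>At the limit 0 the logarithm has no limit of its own, and the bound 2 sqrt x + x^2
  controls the product.\<close>

lemma tendsto_x_ln_x:
  fixes X :: "nat \<Rightarrow> real"
  assumes X: "X \<longlonglongrightarrow> x" and nonneg: "\<And>n. 0 \<le> X n"
  shows "(\<lambda>n. X n * ln (X n)) \<longlonglongrightarrow> x * ln x"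
proof (cases "x = 0")
  case True
  have "(\<lambda>n. 2 * sqrt (X n) + (X n)\<^sup>2) \<longlonglongrightarrow> 2 * sqrt x + x\<^sup>2"
    by (intro tendsto_intros X)
  then have "(\<lambda>n. 2 * sqrt (X n) + (X n)\<^sup>2) \<longlonglongrightarrow> 0"
    using True by simp
  then have "(\<lambda>n. X n * ln (X n)) \<longlonglongrightarrow> 0"
    by (rule Lim_null_comparison[rotated]) (use abs_x_ln_x_le nonneg in auto)
  then show ?thesis using True by simp
next
  case False
  then show ?thesis by (intro tendsto_intros X)
qed

text \<open>Divide f by its mean m. The Mehler operator preserves the mean, so after multiplying
  back by m both entropies are lowered by the same m ln m, and this term remains with coefficient 1
  - a^2 = b^2.\<close>

lemma entropy_mehler_continuous:
  fixes f :: "real \<Rightarrow> real"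
  assumes cont: "continuous_on UNIV f" and c: "0 < c" "\<And>x. c \<le> f x" and C: "\<And>x. f x \<le> C"
    and ab: "a\<^sup>2 + b\<^sup>2 = 1"
  defines "m \<equiv> (\<integral>x. f x \<partial>gauss1)"
  shows "(\<integral>v. mehler a b f v * ln (mehler a b f v) \<partial>gauss1) \<le> a\<^sup>2 * (\<integral>x. f x * ln (f x) \<partial>gauss1) + b\<^sup>2 * (m * ln m)"
proof -
  have [measurable]: "f \<in> borel_measurable borel"
    using cont by (rule borel_measurable_continuous_onI)
  let ?F = "mehler a b f"
  have fb: "\<bar>f x\<bar> \<le> C" for x using c(2)[of x] c(1) C[of x] by simp
  have F: "c \<le> ?F v" "?F v \<le> C" "\<bar>?F v\<bar> \<le> C" "0 < ?F v" for v
    using mehler_bounds[of f c C a b v] c C by auto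
  have f_int: "integrable gauss1 f" by (rule integrable_gauss1_bounded[OF _ fb]) measurable
  have F_int: "integrable gauss1 ?F" by (rule integrable_gauss1_bounded[OF _ F(3)]) measurable
  have "c \<le> m" unfolding m_def by (rule gauss1.integral_ge_const[OF f_int]) (use c in simp)
  then have m: "0 < m" using c by simp
  define K where "K = C * (\<bar>ln c\<bar> + \<bar>ln C\<bar>)"
  have K: "\<bar>t * ln t\<bar> \<le> K" if "c \<le> t" "t \<le> C" for t
    unfolding K_def using c(1) that by (rule abs_x_ln_x_le_const)
  have int: "integrable gauss1 (\<lambda>x. f x * ln (f x))" "integrable gauss1 (\<lambda>x. ?F x * ln (?F x))"
    by (rule integrable_gauss1_bounded[of _ K]; use K c C F in auto)+
  have F_m: "(\<integral>v. ?F v \<partial>gauss1) = m"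
    using integral_mehler[OF _ _ fb _ ab, where \<psi> = "\<lambda>_. 1" and K = 1] by (simp add: m_def)
  have eq: "t / m * ln (t / m) = (t * ln t) / m - t * (ln m / m)" if "0 < t" for t
    using that m by (simp add: ln_div field_simps)
  have mehler_div: "mehler a b (\<lambda>x. f x / m) = (\<lambda>v. ?F v / m)"
    by (simp add: mehler_def fun_eq_iff)
  let ?h = "\<lambda>x. f x / m"
  have "(\<integral>v. mehler a b ?h v * ln (mehler a b ?h v) \<partial>gauss1) \<le> a\<^sup>2 * (\<integral>x. ?h x * ln (?h x) \<partial>gauss1)"
  proof (rule entropy_mehler_continuous_normalized[OF _ _ _ _ _ ab])
    show "continuous_on UNIV ?h" using cont m by (intro continuous_intros) auto
    show "0 < c / m" "\<And>x. c / m \<le> ?h x" "\<And>x. ?h x \<le> C / m"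
      using c C m by (auto intro: divide_right_mono)
    show "(\<integral>x. ?h x \<partial>gauss1) = 1" using m by (simp add: m_def[symmetric])
  qed
  then have "(\<integral>v. ?F v / m * ln (?F v / m) \<partial>gauss1) \<le> a\<^sup>2 * (\<integral>x. f x / m * ln (f x / m) \<partial>gauss1)"
    unfolding mehler_div .
  also have "(\<integral>v. ?F v / m * ln (?F v / m) \<partial>gauss1) = (\<integral>v. ?F v * ln (?F v) \<partial>gauss1) / m - m * (ln m / m)"
    unfolding eq[OF F(4)] using int F_int by (simp add: F_m)
  also have "(\<integral>x. f x / m * ln (f x / m) \<partial>gauss1) = (\<integral>x. f x * ln (f x) \<partial>gauss1) / m - m * (ln m / m)"
    unfolding eq[OF less_le_trans[OF c]] using int f_int by (simp add: m_def[symmetric])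
  finally have le: "(\<integral>v. ?F v * ln (?F v) \<partial>gauss1) / m - m * (ln m / m)
    \<le> a\<^sup>2 * ((\<integral>x. f x * ln (f x) \<partial>gauss1) / m - m * (ln m / m))" .
  have cancel: "m * (z / m - m * (ln m / m)) = z - m * ln m" for z
    using m by (simp add: field_simps)
  have "(\<integral>v. ?F v * ln (?F v) \<partial>gauss1) - m * ln m \<le> a\<^sup>2 * ((\<integral>x. f x * ln (f x) \<partial>gauss1) - m * ln m)"
    using mult_left_mono[OF le less_imp_le[OF m]] unfolding mult.left_commute[of m "a\<^sup>2"] cancel .
  then have "(\<integral>v. ?F v * ln (?F v) \<partial>gauss1) \<le> a\<^sup>2 * (\<integral>x. f x * ln (f x) \<partial>gauss1) + (1 - a\<^sup>2) * (m * ln m)"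
    by (simp add: algebra_simps)
  also have "1 - a\<^sup>2 = b\<^sup>2" using ab by simp
  finally show ?thesis .
qed

text \<open>The law of a v + b w is again Gaussian, so the pullback of a null set is null in the
  product and almost all its sections are null.\<close>

lemma AE_gauss1_rotate:
  assumes ab: "a\<^sup>2 + b\<^sup>2 = 1" and "AE x in gauss1. P x"
  shows "AE v in gauss1. AE w in gauss1. P (a * v + b * w)"
proof -
  obtain N where N: "N \<in> null_sets gauss1" "{x. \<not> P x} \<subseteq> N"
    using assms(2) by (auto simp: eventually_ae_filter)
  then have [measurable]: "N \<in> sets borel" by (simp add: null_sets_def)
  have "(\<integral>\<^sup>+v. \<integral>\<^sup>+w. indicator N (a * v + b * w) \<partial>gauss1 \<partial>gauss1) = (\<integral>\<^sup>+x. \<integral>\<^sup>+w. indicator N x \<partial>gauss1 \<partial>gauss1)"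
    using nn_integral_gauss1_rotate[OF _ ab, of "\<lambda>(x, w). indicator N x"] by simp
  also have "\<dots> = 0"
    using N(1) by (simp add: null_sets_def)
  finally have "AE v in gauss1. (\<integral>\<^sup>+w. indicator N (a * v + b * w) \<partial>gauss1) = 0"
    by (subst (asm) nn_integral_0_iff_AE) auto
  then show ?thesis
  proof eventually_elim
    fix v assume "(\<integral>\<^sup>+w. indicator N (a * v + b * w) \<partial>gauss1) = 0"
    then have "AE w in gauss1. indicator N (a * v + b * w) = (0::ennreal)"
      by (subst (asm) nn_integral_0_iff_AE) auto
    then show "AE w in gauss1. P (a * v + b * w)"
      by eventually_elim (use N(2) in \<open>auto split: split_indicator_asm\<close>)
  qed
qed

text \<open>For almost every v the shifted majorant h(a v + b w) is integrable in w, since its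
  double integral is that of h; dominated convergence then applies at this v.\<close>

lemma tendsto_mehler:
  assumes [measurable]: "f \<in> borel_measurable borel" "\<And>n. g n \<in> borel_measurable borel"
    and lim: "AE x in gauss1. (\<lambda>n. g n x) \<longlonglongrightarrow> f x"
    and h: "integrable gauss1 h" and bd: "\<And>n x. \<bar>g n x\<bar> \<le> h x" and ab: "a\<^sup>2 + b\<^sup>2 = 1"
  shows "AE v in gauss1. (\<lambda>n. mehler a b (g n) v) \<longlonglongrightarrow> mehler a b f v"
proof -
  have [measurable]: "h \<in> borel_measurable borel"
    using borel_measurable_integrable[OF h] by simp
  have "(\<integral>\<^sup>+v. \<integral>\<^sup>+w. norm (h (a * v + b * w)) \<partial>gauss1 \<partial>gauss1) = (\<integral>\<^sup>+x. \<integral>\<^sup>+w. norm (h x) \<partial>gauss1 \<partial>gauss1)"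
    using nn_integral_gauss1_rotate[OF _ ab, of "\<lambda>(x, w). norm (h x)"] by simp
  also have "\<dots> < \<infinity>"
    using h by (simp add: integrable_iff_bounded)
  finally have "AE v in gauss1. (\<integral>\<^sup>+w. norm (h (a * v + b * w)) \<partial>gauss1) \<noteq> \<infinity>"
    by (intro nn_integral_PInf_AE) auto
  with AE_gauss1_rotate[OF ab lim] show ?thesis
  proof eventually_elim
    fix v assume v: "AE w in gauss1. (\<lambda>n. g n (a * v + b * w)) \<longlonglongrightarrow> f (a * v + b * w)"
      "(\<integral>\<^sup>+w. norm (h (a * v + b * w)) \<partial>gauss1) \<noteq> \<infinity>"
    show "(\<lambda>n. mehler a b (g n) v) \<longlonglongrightarrow> mehler a b f v"
      unfolding mehler_def
    proof (rule integral_dominated_convergence)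
      show "integrable gauss1 (\<lambda>w. h (a * v + b * w))"
        using v(2) by (simp add: integrable_iff_bounded top.not_eq_extremum)
    qed (use v bd in auto)
  qed
qed

text \<open>\<open>measurable_on\<close> supplies continuous functions converging to f almost
  everywhere, and the uniform bounds let both sides pass to the limit.\<close>

lemma entropy_mehler_bounded:
  fixes f :: "real \<Rightarrow> real"
  assumes f_meas [measurable]: "f \<in> borel_measurable borel" and c: "0 < c" "\<And>x. c \<le> f x" and C: "\<And>x. f x \<le> C"
    and ab: "a\<^sup>2 + b\<^sup>2 = 1"
  defines "m \<equiv> (\<integral>x. f x \<partial>gauss1)"
  shows "(\<integral>v. mehler a b f v * ln (mehler a b f v) \<partial>gauss1) \<le> a\<^sup>2 * (\<integral>x. f x * ln (f x) \<partial>gauss1) + b\<^sup>2 * (m * ln m)"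
proof -
  have "f measurable_on UNIV"
    by (subst measurable_on_iff_borel_measurable)
      (simp_all add: measurable_restrict_space1 measurable_completion)
  then obtain N g where N: "negligible N" and g: "\<And>n. continuous_on UNIV (g n)"
    and lim: "\<And>x. x \<notin> N \<Longrightarrow> (\<lambda>n. g n x) \<longlonglongrightarrow> f x"
    unfolding measurable_on_def by auto
  \<comment> \<open>Clamping to [c, C] preserves continuity, does not change the limit f, and makes
    the bounds uniform in n.\<close>
  define h where "h n x = max c (min C (g n x))" for n x
  have h_cont: "continuous_on UNIV (h n)" for n
    unfolding h_def by (intro continuous_intros g)
  then have [measurable]: "h n \<in> borel_measurable borel" for n
    by (rule borel_measurable_continuous_onI)
  have "c \<le> C" using c(2)[of 0] C[of 0] by simp
  then have h: "c \<le> h n x" "h n x \<le> C" for n x by (auto simp: h_def)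
  have hb: "\<bar>h n x\<bar> \<le> C" for n x using h[of n x] c(1) by simp
  have H: "c \<le> mehler a b (h n) v" "mehler a b (h n) v \<le> C" for n v
    using mehler_bounds[of "h n" c C a b v] h by auto
  have "AE x in lebesgue. x \<notin> N"
    using N by (intro AE_not_in) (simp add: negligible_iff_null_sets)
  then have "AE x in gauss1. x \<notin> N"
    unfolding AE_gauss1_iff by (simp add: AE_completion_iff)
  then have h_lim: "AE x in gauss1. (\<lambda>n. h n x) \<longlonglongrightarrow> f x"
  proof eventually_elim
    fix x assume "x \<notin> N"
    then have "(\<lambda>n. h n x) \<longlonglongrightarrow> max c (min C (f x))"
      unfolding h_def by (intro tendsto_intros lim)
    moreover have "max c (min C (f x)) = f x" using c(2)[of x] C[of x] by simp
    ultimately show "(\<lambda>n. h n x) \<longlonglongrightarrow> f x" by simp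
  qed
  have H_lim: "AE v in gauss1. (\<lambda>n. mehler a b (h n) v) \<longlonglongrightarrow> mehler a b f v"
    by (rule tendsto_mehler[OF _ _ h_lim _ hb ab]) auto
  define K where "K = C * (\<bar>ln c\<bar> + \<bar>ln C\<bar>)"
  have K: "\<bar>t * ln t\<bar> \<le> K" if "c \<le> t" "t \<le> C" for t
    unfolding K_def using c(1) that by (rule abs_x_ln_x_le_const)
  let ?\<eta> = "\<lambda>t::real. t * ln t"
  have l1: "(\<lambda>n. \<integral>v. ?\<eta> (mehler a b (h n) v) \<partial>gauss1) \<longlonglongrightarrow> (\<integral>v. ?\<eta> (mehler a b f v) \<partial>gauss1)"
  proof (rule integral_dominated_convergence[where w = "\<lambda>_. K"])
    show "AE v in gauss1. (\<lambda>n. ?\<eta> (mehler a b (h n) v)) \<longlonglongrightarrow> ?\<eta> (mehler a b f v)"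
      using H_lim by eventually_elim (rule tendsto_x_ln_x, auto intro: order_trans[OF less_imp_le[OF c(1)] H(1)])
  qed (use K H in auto)
  have l2: "(\<lambda>n. \<integral>v. ?\<eta> (h n v) \<partial>gauss1) \<longlonglongrightarrow> (\<integral>v. ?\<eta> (f v) \<partial>gauss1)"
  proof (rule integral_dominated_convergence[where w = "\<lambda>_. K"])
    show "AE v in gauss1. (\<lambda>n. ?\<eta> (h n v)) \<longlonglongrightarrow> ?\<eta> (f v)"
      using h_lim by eventually_elim (rule tendsto_x_ln_x, auto intro: order_trans[OF less_imp_le[OF c(1)] h(1)])
  qed (use K h in auto)
  have l3: "(\<lambda>n. \<integral>v. h n v \<partial>gauss1) \<longlonglongrightarrow> m"
    unfolding m_def
    by (rule integral_dominated_convergence[where w = "\<lambda>_. C"]) (use hb h_lim in auto)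
  have l4: "(\<lambda>n. ?\<eta> (\<integral>v. h n v \<partial>gauss1)) \<longlonglongrightarrow> ?\<eta> m"
    by (rule tendsto_x_ln_x[OF l3]) (auto intro!: integral_nonneg_AE order_trans[OF less_imp_le[OF c(1)] h(1)])
  show ?thesis
  proof (rule LIMSEQ_le[OF l1])
    show "(\<lambda>n. a\<^sup>2 * (\<integral>v. ?\<eta> (h n v) \<partial>gauss1) + b\<^sup>2 * ?\<eta> (\<integral>v. h n v \<partial>gauss1))
      \<longlonglongrightarrow> a\<^sup>2 * (\<integral>x. f x * ln (f x) \<partial>gauss1) + b\<^sup>2 * (m * ln m)"
      by (intro tendsto_intros l2 l4)
  qed (use entropy_mehler_continuous[OF h_cont c(1) h ab] in blast)
qed

text \<open>The shift by 1 makes \<open>x ln x\<close> nonnegative on \<open>[0, \<infinity>)\<close>. All coefficients in the entropy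
  inequalities sum to 1, so the shift cancels, and Tonelli's theorem applies without integrability
  conditions.\<close>

definition ent :: "ennreal \<Rightarrow> ennreal" where
  "ent x = (if x = \<infinity> then \<infinity> else ennreal (enn2real x * ln (enn2real x) + 1))"

lemma borel_measurable_ent [measurable]: "ent \<in> borel_measurable borel"
  unfolding ent_def by measurable

lemma ent_ennreal: "0 \<le> x \<Longrightarrow> ent (ennreal x) = ennreal (x * ln x + 1)"
  by (simp add: ent_def)

text \<open>The convex function x ln x lies above its tangent x - 1 at 1. Hence a finite integral of
  \<open>ent\<close> forces a finite integral of the function.\<close>

lemma le_ent: "x \<le> ent x"
proof (cases x)
  case (real r)
  then show ?thesis using x_ln_x_ge[of r] by (simp add: ent_ennreal)
qed (simp add: ent_def)

context prob_space
begin

text \<open>The way back from extended values to Bochner integrals: everything follows from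
  \<open>le_ent\<close> and from the nonnegativity of x ln x + 1.\<close>

lemma ent_finite:
  assumes [measurable]: "f \<in> borel_measurable M" and fin: "(\<integral>\<^sup>+x. ent (f x) \<partial>M) < \<infinity>"
  defines "r \<equiv> \<lambda>x. enn2real (f x)"
  shows "AE x in M. f x = ennreal (r x)"
    and "integrable M r"
    and "integrable M (\<lambda>x. r x * ln (r x))"
    and "(\<integral>\<^sup>+x. f x \<partial>M) = ennreal (\<integral>x. r x \<partial>M)"
    and "0 \<le> (\<integral>x. r x * ln (r x) \<partial>M) + 1"
    and "(\<integral>\<^sup>+x. ent (f x) \<partial>M) = ennreal ((\<integral>x. r x * ln (r x) \<partial>M) + 1)"
proof -
  let ?\<eta> = "\<lambda>t::real. t * ln t"
  have "(\<integral>\<^sup>+x. f x \<partial>M) \<le> (\<integral>\<^sup>+x. ent (f x) \<partial>M)"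
    by (intro nn_integral_mono le_ent)
  then have f_fin: "(\<integral>\<^sup>+x. f x \<partial>M) < \<infinity>"
    using fin by (rule le_less_trans)
  have [measurable]: "r \<in> borel_measurable M" unfolding r_def by measurable
  have r_nonneg: "0 \<le> r x" for x by (simp add: r_def)
  show fr: "AE x in M. f x = ennreal (r x)"
    using nn_integral_PInf_AE[of f M] f_fin
    by (auto simp: r_def top.not_eq_extremum elim: eventually_mono)
  have r_nn: "(\<integral>\<^sup>+x. ennreal (r x) \<partial>M) = (\<integral>\<^sup>+x. f x \<partial>M)"
    by (rule nn_integral_cong_AE) (use fr in \<open>auto elim: eventually_mono\<close>)
  show r_int: "integrable M r"
    by (rule integrableI_nonneg) (use r_nn r_nonneg f_fin in auto)
  show "(\<integral>\<^sup>+x. f x \<partial>M) = ennreal (\<integral>x. r x \<partial>M)"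
    using nn_integral_eq_integral[OF r_int] r_nonneg r_nn by simp
  have \<eta>_ge: "0 \<le> ?\<eta> (r x) + 1" for x
    using x_ln_x_ge[OF r_nonneg[of x]] r_nonneg[of x] by simp
  have er: "(\<integral>\<^sup>+x. ennreal (?\<eta> (r x) + 1) \<partial>M) = (\<integral>\<^sup>+x. ent (f x) \<partial>M)"
    by (rule nn_integral_cong_AE) (use fr in \<open>auto elim!: eventually_mono simp: ent_ennreal r_nonneg\<close>)
  have e_int1: "integrable M (\<lambda>x. ?\<eta> (r x) + 1)"
    by (rule integrableI_nonneg) (use er fin \<eta>_ge in auto)
  show e_int: "integrable M (\<lambda>x. ?\<eta> (r x))"
    using Bochner_Integration.integrable_diff[OF e_int1 integrable_const[of 1]] by simp
  have "0 \<le> (\<integral>x. ?\<eta> (r x) + 1 \<partial>M)" using \<eta>_ge by (simp add: integral_nonneg_AE)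
  then show "0 \<le> (\<integral>x. ?\<eta> (r x) \<partial>M) + 1"
    using e_int by (simp add: prob_space)
  show "(\<integral>\<^sup>+x. ent (f x) \<partial>M) = ennreal ((\<integral>x. ?\<eta> (r x) \<partial>M) + 1)"
    using nn_integral_eq_integral[OF e_int1] \<eta>_ge e_int by (simp add: er prob_space)
qed

text \<open>Used to pass finiteness of the entropy from a function to its marginals.\<close>

lemma jensen_ent:
  assumes [measurable]: "f \<in> borel_measurable M"
  shows "ent (\<integral>\<^sup>+x. f x \<partial>M) \<le> (\<integral>\<^sup>+x. ent (f x) \<partial>M)"
proof (cases "(\<integral>\<^sup>+x. ent (f x) \<partial>M) < \<infinity>")
  case True
  note f = ent_finite[OF assms True]
  define r where "r x = enn2real (f x)" for x
  note f = f[folded r_def]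
  define m where "m = (\<integral>x. r x \<partial>M)"
  have r: "0 \<le> r x" for x by (simp add: r_def)
  then have m: "0 \<le> m" unfolding m_def by (simp add: integral_nonneg_AE)
  have "m * ln m \<le> (\<integral>x. r x * ln (r x) \<partial>M)"
  proof (cases "m = 0")
    case True
    then have "AE x in M. r x = 0"
      using integral_nonneg_eq_0_iff_AE[OF f(2)] r unfolding m_def by simp
    then have "AE x in M. r x * ln (r x) = 0" by eventually_elim simp
    then have "(\<integral>x. r x * ln (r x) \<partial>M) = 0"
      by (rule integral_eq_zero_AE)
    then show ?thesis using True by simp
  next
    case False
    with m have m: "0 < m" by simp
    \<comment> \<open>The tangent of x ln x at m, obtained by scaling the tangent at 1. For m = 0
      there is no tangent, but then r vanishes almost everywhere.\<close>
    have le: "r x * ln m + (r x - m) \<le> r x * ln (r x)" for x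
    proof -
      have q: "0 \<le> r x / m" using r[of x] m by simp
      have "m * (r x / m - 1) \<le> m * (r x / m * ln (r x / m))"
        using x_ln_x_ge[OF q] m by (intro mult_left_mono) auto
      then have "r x - m \<le> r x * ln (r x / m)" using m by (simp add: right_diff_distrib)
      then show ?thesis
        using r[of x] m by (cases "r x = 0") (auto simp: ln_div right_diff_distrib)
    qed
    have "(\<integral>x. r x * ln m + (r x - m) \<partial>M) \<le> (\<integral>x. r x * ln (r x) \<partial>M)"
      by (rule integral_mono[OF _ f(3)]) (use f(2) le in auto)
    then show ?thesis using f(2) by (simp add: m_def[symmetric] prob_space)
  qed
  then show ?thesis
    unfolding f(6) f(4) m_def[symmetric] ent_ennreal[OF m] by (intro ennreal_leI) simp
qed (simp add: not_less top_unique)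

end

text \<open>The last two bounds are the majorants for removing the truncation. For entropy, the
  lower cut-off 1/u lies in (0, 1], where |s ln s| <= 1, and above 1 the function s ln s increases,
  so cutting at u lowers it.\<close>

lemma truncate_bounds:
  fixes t u :: real
  assumes "0 \<le> t" "1 \<le> u"
  defines "s \<equiv> max (1 / u) (min t u)"
  shows "1 / u \<le> s" "s \<le> u" "\<bar>s\<bar> \<le> t + 1" "\<bar>s * ln s\<bar> \<le> \<bar>t * ln t\<bar> + 1"
proof -
  define l where "l = 1 / u"
  have l: "l \<le> 1" "0 < l" "l \<le> u" using assms(2) by (auto simp: l_def field_simps intro: order_trans)
  have s: "s = max l (min t u)" by (simp add: s_def l_def)
  show "1 / u \<le> s" unfolding s l_def[symmetric] by simp
  show "s \<le> u" using l by (simp add: s)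
  show "\<bar>s\<bar> \<le> t + 1" using l assms(1) by (auto simp: s max_def min_def)
  consider "t \<le> l" | "l < t" "t \<le> u" | "u < t" by linarith
  then show "\<bar>s * ln s\<bar> \<le> \<bar>t * ln t\<bar> + 1"
  proof cases
    case 1
    then have "s = l" using l by (simp add: s)
    moreover have "l * ln l \<le> 0" using l by (intro mult_nonneg_nonpos) auto
    moreover have "l - 1 \<le> l * ln l" using l by (intro x_ln_x_ge) simp
    ultimately have "\<bar>l * ln l\<bar> \<le> 1" using l by linarith
    then show ?thesis using \<open>s = l\<close> by simp
  next
    case 2
    then show ?thesis by (simp add: s)
  next
    case 3
    then have "s = u" using l by (simp add: s)
    moreover have "0 \<le> u * ln u" using assms(2) by simp
    moreover have "u * ln u \<le> t * ln t" using 3 assms(2) by (intro mult_mono) auto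
    ultimately show ?thesis by simp
  qed
qed

text \<open>Truncate, apply the bounded case, and let the truncation go. The right side converges by
  domination; the left side is controlled by Fatou's lemma.\<close>

lemma entropy_mehler_ennreal:
  fixes f :: "real \<Rightarrow> ennreal"
  assumes f_meas [measurable]: "f \<in> borel_measurable borel" and ab: "a\<^sup>2 + b\<^sup>2 = 1"
  shows "(\<integral>\<^sup>+v. ent (\<integral>\<^sup>+w. f (a * v + b * w) \<partial>gauss1) \<partial>gauss1)
    \<le> ennreal (a\<^sup>2) * (\<integral>\<^sup>+x. ent (f x) \<partial>gauss1) + ennreal (b\<^sup>2) * ent (\<integral>\<^sup>+x. f x \<partial>gauss1)"
proof (cases "(\<integral>\<^sup>+x. ent (f x) \<partial>gauss1) = \<infinity>")
  case True
  show ?thesis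
  \<comment> \<open>Since 0 times infinity is 0 in \<open>ennreal\<close>, an infinite entropy does
    not make the right side infinite when a = 0. There P f is constant, equal to the mean of f, and
    both sides agree.\<close>
  proof (cases "a = 0")
    case True
    then have "b\<^sup>2 = 1" using ab by simp
    have "(\<integral>\<^sup>+v. \<integral>\<^sup>+w. f (a * v + b * w) \<partial>gauss1 \<partial>gauss1) = (\<integral>\<^sup>+x. \<integral>\<^sup>+w. f x \<partial>gauss1 \<partial>gauss1)"
      using nn_integral_gauss1_rotate[OF _ ab, of "\<lambda>(x, w). f x"] by simp
    then show ?thesis using True \<open>b\<^sup>2 = 1\<close> by simp
  next
    case False
    then show ?thesis using True by (simp add: ennreal_mult_top)
  qed
next
  case False
  let ?\<eta> = "\<lambda>t::real. t * ln t"
  from False have fin: "(\<integral>\<^sup>+x. ent (f x) \<partial>gauss1) < \<infinity>"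
    by (simp add: top.not_eq_extremum)
  have "f \<in> borel_measurable gauss1" by measurable
  note F = gauss1.ent_finite[OF this fin]
  define r where "r x = enn2real (f x)" for x
  note fr = F(1)[folded r_def] and r_int = F(2)[folded r_def] and e_int = F(3)[folded r_def]
  have [measurable]: "r \<in> borel_measurable borel" unfolding r_def by measurable
  have r_nonneg: "0 \<le> r x" for x by (simp add: r_def)
  define m where "m = (\<integral>x. r x \<partial>gauss1)"
  have m: "0 \<le> m" unfolding m_def using r_nonneg by (simp add: integral_nonneg_AE)
  have m_nn: "(\<integral>\<^sup>+x. f x \<partial>gauss1) = ennreal m"
    using F(4) by (simp add: m_def r_def)
  then have f_fin: "(\<integral>\<^sup>+x. f x \<partial>gauss1) < \<infinity>" by simp
  have \<eta>_ge: "0 \<le> ?\<eta> t + 1" if "0 \<le> t" for t :: real using x_ln_x_ge[OF that] that by simp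
  have e_nn: "(\<integral>\<^sup>+x. ent (f x) \<partial>gauss1) = ennreal ((\<integral>x. ?\<eta> (r x) \<partial>gauss1) + 1)"
    using F(6) by (simp add: r_def)
  \<comment> \<open>Cut-offs 1/(1 + n) and 1 + n, so that the level is at least 1 already for n =
    0.\<close>
  define g where "g n x = max (1 / (1 + real n)) (min (r x) (1 + real n))" for n x
  have [measurable]: "g n \<in> borel_measurable borel" for n unfolding g_def by measurable
  note g = truncate_bounds[OF r_nonneg, of "1 + real _", folded g_def, simplified]
  have g_lim: "(\<lambda>n. g n x) \<longlonglongrightarrow> r x" for x
  proof -
    have "(\<lambda>n. 1 / (1 + real n)) \<longlonglongrightarrow> 0"
      using LIMSEQ_inverse_real_of_nat by (simp add: inverse_eq_divide add.commute)
    then have "(\<lambda>n. max (1 / (1 + real n)) (r x)) \<longlonglongrightarrow> max 0 (r x)"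
      by (intro tendsto_intros)
    moreover obtain k where k: "r x \<le> real k" using real_arch_simple by blast
    have "\<forall>\<^sub>F n in sequentially. max (1 / (1 + real n)) (r x) = g n x"
      using eventually_ge_at_top[of k]
    proof eventually_elim
      fix n assume "k \<le> n"
      then have "r x \<le> 1 + real n" using k by linarith
      then show "max (1 / (1 + real n)) (r x) = g n x" by (simp add: g_def)
    qed
    ultimately have "(\<lambda>n. g n x) \<longlonglongrightarrow> max 0 (r x)"
      by (rule Lim_transform_eventually)
    then show ?thesis using r_nonneg[of x] by (simp add: max_def)
  qed
  have dom: "integrable gauss1 (\<lambda>x. r x + 1)" using r_int by simp
  have G: "1 / (1 + real n) \<le> mehler a b (g n) v" "mehler a b (g n) v \<le> 1 + real n" for n v
    using mehler_bounds[of "g n" "1 / (1 + real n)" "1 + real n" a b v] g by auto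
  have pos: "0 < 1 / (1 + real n)" for n by simp
  have g_nonneg: "0 \<le> g n v" for n v using g(1)[of n v] pos[of n] by linarith
  have G_pos: "0 \<le> mehler a b (g n) v" for n v using G(1)[of n v] pos[of n] by linarith
  have G_lim: "AE v in gauss1. (\<lambda>n. mehler a b (g n) v) \<longlonglongrightarrow> mehler a b r v"
    by (rule tendsto_mehler[OF _ _ _ dom _ ab]) (use g_lim g in auto)
  have "(\<integral>\<^sup>+v. \<integral>\<^sup>+w. f (a * v + b * w) \<partial>gauss1 \<partial>gauss1) = (\<integral>\<^sup>+x. \<integral>\<^sup>+w. f x \<partial>gauss1 \<partial>gauss1)"
    using nn_integral_gauss1_rotate[OF _ ab, of "\<lambda>(x, w). f x"] by simp
  then have "AE v in gauss1. (\<integral>\<^sup>+w. f (a * v + b * w) \<partial>gauss1) \<noteq> \<infinity>"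
    using f_fin by (intro nn_integral_PInf_AE) auto
  with AE_gauss1_rotate[OF ab fr]
  \<comment> \<open>For almost every v the integrand is almost everywhere finite and integrable in
    w, so the extended integral is the real Mehler operator of \<open>r\<close>.\<close>
  have PF: "AE v in gauss1. (\<integral>\<^sup>+w. f (a * v + b * w) \<partial>gauss1) = ennreal (mehler a b r v)"
  proof eventually_elim
    fix v assume v: "AE w in gauss1. f (a * v + b * w) = ennreal (r (a * v + b * w))"
      "(\<integral>\<^sup>+w. f (a * v + b * w) \<partial>gauss1) \<noteq> \<infinity>"
    have eq: "(\<integral>\<^sup>+w. ennreal (r (a * v + b * w)) \<partial>gauss1) = (\<integral>\<^sup>+w. f (a * v + b * w) \<partial>gauss1)"
      by (rule nn_integral_cong_AE) (use v(1) in \<open>auto elim: eventually_mono\<close>)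
    have "integrable gauss1 (\<lambda>w. r (a * v + b * w))"
      by (rule integrableI_nonneg) (use v(2) eq r_nonneg in \<open>auto simp: top.not_eq_extremum\<close>)
    then show "(\<integral>\<^sup>+w. f (a * v + b * w) \<partial>gauss1) = ennreal (mehler a b r v)"
      unfolding eq[symmetric] mehler_def by (rule nn_integral_eq_integral) (simp add: r_nonneg)
  qed
  have R_nonneg: "0 \<le> mehler a b r v" for v
    unfolding mehler_def using r_nonneg by (simp add: integral_nonneg_AE)
  let ?V = "\<lambda>n. ennreal (a\<^sup>2 * (\<integral>x. ?\<eta> (g n x) \<partial>gauss1) + b\<^sup>2 * ?\<eta> (\<integral>x. g n x \<partial>gauss1) + 1)"
  have "(\<integral>\<^sup>+v. ent (\<integral>\<^sup>+w. f (a * v + b * w) \<partial>gauss1) \<partial>gauss1)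
    = (\<integral>\<^sup>+v. liminf (\<lambda>n. ennreal (?\<eta> (mehler a b (g n) v) + 1)) \<partial>gauss1)"
  proof (rule nn_integral_cong_AE)
    show "AE v in gauss1. ent (\<integral>\<^sup>+w. f (a * v + b * w) \<partial>gauss1) = liminf (\<lambda>n. ennreal (?\<eta> (mehler a b (g n) v) + 1))"
      using PF G_lim
    proof eventually_elim
      fix v assume v: "(\<integral>\<^sup>+w. f (a * v + b * w) \<partial>gauss1) = ennreal (mehler a b r v)"
        "(\<lambda>n. mehler a b (g n) v) \<longlonglongrightarrow> mehler a b r v"
      have "(\<lambda>n. ennreal (?\<eta> (mehler a b (g n) v) + 1)) \<longlonglongrightarrow> ennreal (?\<eta> (mehler a b r v) + 1)"
        by (intro tendsto_intros tendsto_ennrealI tendsto_x_ln_x v G_pos)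
      from lim_imp_Liminf[OF _ this]
      show "ent (\<integral>\<^sup>+w. f (a * v + b * w) \<partial>gauss1) = liminf (\<lambda>n. ennreal (?\<eta> (mehler a b (g n) v) + 1))"
        by (simp add: v ent_ennreal R_nonneg)
    qed
  qed
  \<comment> \<open>Fatou's lemma, applicable because the shifted entropy is nonnegative.\<close>
  also have "\<dots> \<le> liminf (\<lambda>n. \<integral>\<^sup>+v. ennreal (?\<eta> (mehler a b (g n) v) + 1) \<partial>gauss1)"
    by (rule nn_integral_liminf) measurable
  also have "\<dots> \<le> liminf ?V"
  proof (intro Liminf_mono always_eventually allI)
    fix n
    define K where "K = (1 + real n) * (\<bar>ln (1 / (1 + real n))\<bar> + \<bar>ln (1 + real n)\<bar>)"
    have K: "\<bar>?\<eta> t\<bar> \<le> K" if "1 / (1 + real n) \<le> t" "t \<le> 1 + real n" for t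
      unfolding K_def using pos that by (rule abs_x_ln_x_le_const)
    have int: "integrable gauss1 (\<lambda>v. ?\<eta> (mehler a b (g n) v))"
      by (rule integrable_gauss1_bounded[of _ K]) (use K G in auto)
    have "(\<integral>\<^sup>+v. ennreal (?\<eta> (mehler a b (g n) v) + 1) \<partial>gauss1) = ennreal ((\<integral>v. ?\<eta> (mehler a b (g n) v) + 1 \<partial>gauss1))"
      by (rule nn_integral_eq_integral) (use int \<eta>_ge G_pos in auto)
    also have "\<dots> \<le> ?V n"
      using entropy_mehler_bounded[OF \<open>g n \<in> borel_measurable borel\<close> pos g(1) g(2) ab] int by (intro ennreal_leI) simp
    finally show "(\<integral>\<^sup>+v. ennreal (?\<eta> (mehler a b (g n) v) + 1) \<partial>gauss1) \<le> ?V n" .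
  qed
  also have "liminf ?V = ennreal (a\<^sup>2 * (\<integral>x. ?\<eta> (r x) \<partial>gauss1) + b\<^sup>2 * ?\<eta> m + 1)"
  proof (rule lim_imp_Liminf)
    have l2: "(\<lambda>n. \<integral>v. ?\<eta> (g n v) \<partial>gauss1) \<longlonglongrightarrow> (\<integral>v. ?\<eta> (r v) \<partial>gauss1)"
    proof (rule integral_dominated_convergence[where w = "\<lambda>v. \<bar>?\<eta> (r v)\<bar> + 1"])
      show "AE v in gauss1. (\<lambda>n. ?\<eta> (g n v)) \<longlonglongrightarrow> ?\<eta> (r v)"
        by (intro AE_I2 tendsto_x_ln_x g_lim g_nonneg)
    qed (use e_int g in auto)
    have l3: "(\<lambda>n. \<integral>v. g n v \<partial>gauss1) \<longlonglongrightarrow> m"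
      unfolding m_def
      by (rule integral_dominated_convergence[where w = "\<lambda>v. r v + 1"]) (use dom g g_lim in auto)
    have l4: "(\<lambda>n. ?\<eta> (\<integral>v. g n v \<partial>gauss1)) \<longlonglongrightarrow> ?\<eta> m"
      by (intro tendsto_x_ln_x[OF l3]) (simp add: integral_nonneg_AE g_nonneg)
    show "?V \<longlonglongrightarrow> ennreal (a\<^sup>2 * (\<integral>x. ?\<eta> (r x) \<partial>gauss1) + b\<^sup>2 * ?\<eta> m + 1)"
      by (intro tendsto_intros tendsto_ennrealI l2 l4)
  qed simp
  \<comment> \<open>The shift 1 is split as a^2 + b^2 between the two terms.\<close>
  also have "\<dots> = ennreal (a\<^sup>2) * ennreal ((\<integral>x. ?\<eta> (r x) \<partial>gauss1) + 1) + ennreal (b\<^sup>2) * ennreal (?\<eta> m + 1)"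
  proof -
    have "0 \<le> (\<integral>x. ?\<eta> (r x) + 1 \<partial>gauss1)"
      using \<eta>_ge r_nonneg by (simp add: integral_nonneg_AE)
    then have nn: "0 \<le> (\<integral>x. ?\<eta> (r x) \<partial>gauss1) + 1" using e_int by simp
    have "a\<^sup>2 * (\<integral>x. ?\<eta> (r x) \<partial>gauss1) + b\<^sup>2 * ?\<eta> m + 1
      = a\<^sup>2 * ((\<integral>x. ?\<eta> (r x) \<partial>gauss1) + 1) + b\<^sup>2 * (?\<eta> m + 1)"
      using ab by (simp add: algebra_simps)
    then show ?thesis using nn \<eta>_ge[OF m] by (simp add: ennreal_plus ennreal_mult)
  qed
  also have "\<dots> = ennreal (a\<^sup>2) * (\<integral>\<^sup>+x. ent (f x) \<partial>gauss1) + ennreal (b\<^sup>2) * ent (\<integral>\<^sup>+x. f x \<partial>gauss1)"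
    by (simp add: e_nn m_nn ent_ennreal m)
  finally show ?thesis .
qed

subsection \<open>Orthogonal invariance of the Gaussian measure\<close>

interpretation gaussP: product_sigma_finite "\<lambda>_::nat. gauss1"
  unfolding product_sigma_finite_def by (simp add: gauss1.sigma_finite_measure_axioms)

interpretation lborelP: product_sigma_finite "\<lambda>_::nat. lborel :: real measure"
  unfolding product_sigma_finite_def by (simp add: sigma_finite_lborel)

abbreviation lborelM :: "nat set \<Rightarrow> (nat \<Rightarrow> real) measure" where
  "lborelM I \<equiv> PiM I (\<lambda>_. lborel)"

lemma sets_gaussM_lborelM: "sets (gaussM I) = sets (lborelM I)"
  unfolding gaussM_def by (rule sets_PiM_cong) auto

lemma space_gaussM: "space (gaussM I) = extensional I"
  by (simp add: gaussM_def space_PiM PiE_UNIV_domain) (auto simp: PiE_def)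

lemma space_lborelM: "space (lborelM I) = extensional I"
  by (auto simp: space_PiM PiE_def)

lemma prob_space_gaussM: "prob_space (gaussM I)"
  unfolding gaussM_def by (intro prob_space_PiM gauss1.prob_space_axioms)

lemma gaussM_eq_density:
  assumes "finite I"
  shows "gaussM I = density (lborelM I) (\<lambda>x. \<Prod>i\<in>I. ennreal (exp (- pi * (x i)\<^sup>2)))" (is "_ = ?D")
proof -
  have "?D = PiM I (\<lambda>_. gauss1)"
  proof (rule gaussP.PiM_eqI[OF assms])
    show "sets ?D = sets (PiM I (\<lambda>_. gauss1))"
      using sets_gaussM_lborelM[of I] by (simp add: gaussM_def)
    fix A :: "nat \<Rightarrow> real set" assume A: "\<And>i. i \<in> I \<Longrightarrow> A i \<in> sets gauss1"
    then have box: "Pi\<^sub>E I A \<in> sets (lborelM I)"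
      using assms by (intro sets_PiM_I_finite) auto
    have "emeasure ?D (Pi\<^sub>E I A) = (\<integral>\<^sup>+x. (\<Prod>i\<in>I. ennreal (exp (- pi * (x i)\<^sup>2))) * indicator (Pi\<^sub>E I A) x \<partial>lborelM I)"
      by (rule emeasure_density) (use box in measurable)
    also have "\<dots> = (\<integral>\<^sup>+x. (\<Prod>i\<in>I. ennreal (exp (- pi * (x i)\<^sup>2)) * indicator (A i) (x i)) \<partial>lborelM I)"
    proof (rule nn_integral_cong)
      fix x assume x: "x \<in> space (lborelM I)"
      have "indicator (Pi\<^sub>E I A) x = (\<Prod>i\<in>I. indicator (A i) (x i) :: ennreal)"
      proof (cases "\<forall>i\<in>I. x i \<in> A i")
        case True
        then show ?thesis using x by (auto simp: space_lborelM PiE_def indicator_def)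
      next
        case False
        then have "x \<notin> Pi\<^sub>E I A" "\<exists>i\<in>I. indicator (A i) (x i) = (0::ennreal)"
          by (auto simp: PiE_def Pi_def indicator_def)
        then show ?thesis using assms by (simp add: prod_zero)
      qed
      then show "(\<Prod>i\<in>I. ennreal (exp (- pi * (x i)\<^sup>2))) * indicator (Pi\<^sub>E I A) x
        = (\<Prod>i\<in>I. ennreal (exp (- pi * (x i)\<^sup>2)) * indicator (A i) (x i))"
        by (simp add: prod.distrib)
    qed
    also have "\<dots> = (\<Prod>i\<in>I. \<integral>\<^sup>+x. ennreal (exp (- pi * x\<^sup>2)) * indicator (A i) x \<partial>lborel)"
      by (rule lborelP.product_nn_integral_prod[OF assms]) (use A in measurable)
    also have "\<dots> = (\<Prod>i\<in>I. emeasure gauss1 (A i))"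
    proof (rule prod.cong[OF refl])
      fix i assume "i \<in> I"
      then show "(\<integral>\<^sup>+x. ennreal (exp (- pi * x\<^sup>2)) * indicator (A i) x \<partial>lborel) = emeasure gauss1 (A i)"
        unfolding gauss1_def using A[OF \<open>i \<in> I\<close>] by (subst emeasure_density) auto
    qed
    finally show "emeasure ?D (Pi\<^sub>E I A) = (\<Prod>i\<in>I. emeasure gauss1 (A i))" .
  qed
  then show ?thesis by (simp add: gaussM_def)
qed

text \<open>The sign e = -1 is for integrating f(L x - y) in y, which arises once the roles of the
  two functions are exchanged.\<close>

lemma nn_integral_lborelM_shift:
  assumes I: "finite I" and [measurable]: "f \<in> borel_measurable (lborelM I)" and e: "e = 1 \<or> e = -1"
  shows "(\<integral>\<^sup>+x. f (\<lambda>i\<in>I. t i + e * x i) \<partial>lborelM I) = (\<integral>\<^sup>+x. f x \<partial>lborelM I)"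
proof -
  let ?s = "\<lambda>x. \<lambda>i\<in>I. t i + e * x i"
  have s [measurable]: "?s \<in> lborelM I \<rightarrow>\<^sub>M lborelM I"
    by (rule measurable_restrict) measurable
  have "distr (lborelM I) (lborelM I) ?s = lborelM I"
  proof (rule lborelP.PiM_eqI[OF I])
    fix A :: "nat \<Rightarrow> real set" assume A: "\<And>i. i \<in> I \<Longrightarrow> A i \<in> sets lborel"
    have box: "Pi\<^sub>E I A \<in> sets (lborelM I)"
      using I A by (intro sets_PiM_I_finite) auto
    have "emeasure (distr (lborelM I) (lborelM I) ?s) (Pi\<^sub>E I A) = emeasure (lborelM I) (?s -` Pi\<^sub>E I A \<inter> space (lborelM I))"
      by (rule emeasure_distr[OF s box])
    also have "?s -` Pi\<^sub>E I A \<inter> space (lborelM I) = (\<Pi>\<^sub>E i\<in>I. (\<lambda>x. t i + e * x) -` A i)"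
      by (auto simp: space_lborelM PiE_def Pi_def)
    also have "emeasure (lborelM I) \<dots> = (\<Prod>i\<in>I. emeasure lborel ((\<lambda>x. t i + e * x) -` A i))"
    proof (rule lborelP.emeasure_PiM[OF I])
      fix i assume "i \<in> I"
      then have [measurable]: "A i \<in> sets borel" using A by simp
      have "(\<lambda>x. t i + e * x) -` A i \<inter> space borel \<in> sets borel"
        by (rule measurable_sets) measurable
      then show "(\<lambda>x. t i + e * x) -` A i \<in> sets lborel" by simp
    qed
    also have "\<dots> = (\<Prod>i\<in>I. emeasure lborel (A i))"
    proof (rule prod.cong[OF refl])
      fix i assume i: "i \<in> I"
      have "e \<noteq> 0" "\<bar>e\<bar> = 1" using e by auto
      then have eq: "lborel = distr lborel borel (\<lambda>x. t i + e * x)"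
        using lborel_real_affine[of e "t i"] by (simp add: density_1)
      have "emeasure lborel (A i) = emeasure (distr lborel borel (\<lambda>x. t i + e * x)) (A i)"
        by (subst eq) (rule refl)
      also have "\<dots> = emeasure lborel ((\<lambda>x. t i + e * x) -` A i)"
        using A[OF i] by (subst emeasure_distr) auto
      finally show "emeasure lborel ((\<lambda>x. t i + e * x) -` A i) = emeasure lborel (A i)" ..
    qed
    finally show "emeasure (distr (lborelM I) (lborelM I) ?s) (Pi\<^sub>E I A) = (\<Prod>i\<in>I. emeasure lborel (A i))" .
  qed simp
  then have "(\<integral>\<^sup>+x. f x \<partial>lborelM I) = (\<integral>\<^sup>+x. f x \<partial>distr (lborelM I) (lborelM I) ?s)" by simp
  also have "\<dots> = (\<integral>\<^sup>+x. f (?s x) \<partial>lborelM I)"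
    by (rule nn_integral_distr) measurable
  finally show ?thesis ..
qed

text \<open>The Fubini proof of the uniqueness of translation-invariant measures, applied to the image of
  Lebesgue measure under \<open>L\<close>. It replaces the determinant formula: for an orthogonal \<open>L\<close>, taking \<open>g\<close>
  to be the Gaussian density shows that the proportionality factor is 1.\<close>

lemma nn_integral_lborelM_additive:
  fixes L :: "(nat \<Rightarrow> real) \<Rightarrow> nat \<Rightarrow> real"
  assumes I: "finite I" and L [measurable]: "L \<in> lborelM I \<rightarrow>\<^sub>M lborelM I"
    and Lsurj: "\<And>y. \<exists>t. \<forall>x. L (\<lambda>i\<in>I. t i + 1 * x i) = (\<lambda>i\<in>I. L x i - y i)"
    and [measurable]: "f \<in> borel_measurable (lborelM I)" "g \<in> borel_measurable (lborelM I)"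
  shows "(\<integral>\<^sup>+x. f (L x) \<partial>lborelM I) * (\<integral>\<^sup>+x. g x \<partial>lborelM I) = (\<integral>\<^sup>+x. g (L x) \<partial>lborelM I) * (\<integral>\<^sup>+x. f x \<partial>lborelM I)"
proof -
  interpret I: sigma_finite_measure "lborelM I" by (rule lborelP.sigma_finite[OF I])
  interpret II: pair_sigma_finite "lborelM I" "lborelM I" ..
  have c: "(\<lambda>x. x i) \<in> borel_measurable (lborelM I)" if "i \<in> I" for i
    using measurable_component_singleton[OF that, of "\<lambda>_. lborel :: real measure"] by simp
  have Lc: "(\<lambda>x. L x i) \<in> borel_measurable (lborelM I)" if "i \<in> I" for i
    using measurable_compose[OF L c[OF that]] .
  have meas: "(\<lambda>(x, y). \<lambda>i\<in>I. L x i + e * y i) \<in> lborelM I \<Otimes>\<^sub>M lborelM I \<rightarrow>\<^sub>M lborelM I" for e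
    unfolding split_beta' measurable_lborel1
    by (rule measurable_restrict, unfold measurable_lborel1)
      (intro borel_measurable_add borel_measurable_times borel_measurable_const
        measurable_compose[OF measurable_fst Lc] measurable_compose[OF measurable_snd c])
  have meas1: "(\<lambda>y. \<lambda>i\<in>I. L x i + e * y i) \<in> lborelM I \<rightarrow>\<^sub>M lborelM I" for e x
    by (rule measurable_restrict, unfold measurable_lborel1)
      (intro borel_measurable_add borel_measurable_times borel_measurable_const c)
  have meas2: "(\<lambda>x. \<lambda>i\<in>I. L x i + e * y i) \<in> lborelM I \<rightarrow>\<^sub>M lborelM I" for e y
    by (rule measurable_restrict, unfold measurable_lborel1)
      (intro borel_measurable_add borel_measurable_times borel_measurable_const Lc)
  have g1 [measurable]: "(\<lambda>z. g (\<lambda>i\<in>I. L (fst z) i + e * snd z i)) \<in> borel_measurable (lborelM I \<Otimes>\<^sub>M lborelM I)" for e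
    using measurable_compose[OF meas, of g borel e] by (simp add: split_beta')
  have f1 [measurable]: "(\<lambda>z. f (\<lambda>i\<in>I. L (fst z) i + e * snd z i)) \<in> borel_measurable (lborelM I \<Otimes>\<^sub>M lborelM I)" for e
    using measurable_compose[OF meas, of f borel e] by (simp add: split_beta')
  have f2 [measurable]: "(\<lambda>x. f (\<lambda>i\<in>I. L x i + e * y i)) \<in> borel_measurable (lborelM I)" for e y
    using measurable_compose[OF meas2, of f] by simp
  have "(\<integral>\<^sup>+x. f (L x) \<partial>lborelM I) * (\<integral>\<^sup>+x. g x \<partial>lborelM I) = (\<integral>\<^sup>+x. f (L x) * (\<integral>\<^sup>+y. g y \<partial>lborelM I) \<partial>lborelM I)"
    by (rule nn_integral_multc[symmetric]) measurable
  also have "\<dots> = (\<integral>\<^sup>+x. f (L x) * (\<integral>\<^sup>+y. g (\<lambda>i\<in>I. L x i + 1 * y i) \<partial>lborelM I) \<partial>lborelM I)"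
    by (subst nn_integral_lborelM_shift[OF I]) auto
  also have "\<dots> = (\<integral>\<^sup>+x. (\<integral>\<^sup>+y. f (L x) * g (\<lambda>i\<in>I. L x i + 1 * y i) \<partial>lborelM I) \<partial>lborelM I)"
    by (rule nn_integral_cong, rule nn_integral_cmult[symmetric], rule measurable_compose[OF meas1]) measurable
  also have "\<dots> = (\<integral>\<^sup>+y. (\<integral>\<^sup>+x. f (L x) * g (\<lambda>i\<in>I. L x i + 1 * y i) \<partial>lborelM I) \<partial>lborelM I)"
    by (rule II.Fubini'[symmetric]) (unfold split_beta', measurable)
  also have "\<dots> = (\<integral>\<^sup>+y. (\<integral>\<^sup>+x. f (\<lambda>i\<in>I. L x i + -1 * y i) * g (L x) \<partial>lborelM I) \<partial>lborelM I)"
  proof (rule nn_integral_cong)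
    fix y :: "nat \<Rightarrow> real"
    \<comment> \<open>Translating x by \<open>t\<close> turns L x into L x - y, so the argument L x
      + y of \<open>g\<close> becomes L x and that of \<open>f\<close> becomes L x - y.\<close>
    obtain t where t: "\<And>x. L (\<lambda>i\<in>I. t i + 1 * x i) = (\<lambda>i\<in>I. L x i - y i)"
      using Lsurj[of y] by blast
    have Lx: "L x \<in> extensional I" if "x \<in> extensional I" for x
      using measurable_space[OF L, of x] that by (simp add: space_lborelM)
    have m: "(\<lambda>x. f (L x) * g (\<lambda>i\<in>I. L x i + 1 * y i)) \<in> borel_measurable (lborelM I)"
      by (intro borel_measurable_times_ennreal measurable_compose[OF L] measurable_compose[OF meas2]) measurable
    have "(\<integral>\<^sup>+x. f (L x) * g (\<lambda>i\<in>I. L x i + 1 * y i) \<partial>lborelM I)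
      = (\<integral>\<^sup>+x. f (L (\<lambda>i\<in>I. t i + 1 * x i)) * g (\<lambda>i\<in>I. L (\<lambda>i\<in>I. t i + 1 * x i) i + 1 * y i) \<partial>lborelM I)"
      by (rule nn_integral_lborelM_shift[OF I m, symmetric]) simp
    also have "\<dots> = (\<integral>\<^sup>+x. f (\<lambda>i\<in>I. L x i + -1 * y i) * g (L x) \<partial>lborelM I)"
    proof (rule nn_integral_cong)
      fix x assume "x \<in> space (lborelM I)"
      then have "L x \<in> extensional I" by (intro Lx) (simp add: space_lborelM)
      then have "(\<lambda>i\<in>I. (\<lambda>i\<in>I. L x i - y i) i + 1 * y i) = L x"
        by (auto simp: restrict_def extensional_def fun_eq_iff)
      then show "f (L (\<lambda>i\<in>I. t i + 1 * x i)) * g (\<lambda>i\<in>I. L (\<lambda>i\<in>I. t i + 1 * x i) i + 1 * y i)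
        = f (\<lambda>i\<in>I. L x i + -1 * y i) * g (L x)"
        unfolding t by simp
    qed
    finally show "(\<integral>\<^sup>+x. f (L x) * g (\<lambda>i\<in>I. L x i + 1 * y i) \<partial>lborelM I)
      = (\<integral>\<^sup>+x. f (\<lambda>i\<in>I. L x i + -1 * y i) * g (L x) \<partial>lborelM I)" .
  qed
  also have "\<dots> = (\<integral>\<^sup>+x. (\<integral>\<^sup>+y. f (\<lambda>i\<in>I. L x i + -1 * y i) * g (L x) \<partial>lborelM I) \<partial>lborelM I)"
    by (rule II.Fubini') (unfold split_beta', measurable)
  also have "\<dots> = (\<integral>\<^sup>+x. (\<integral>\<^sup>+y. f (\<lambda>i\<in>I. L x i + -1 * y i) \<partial>lborelM I) * g (L x) \<partial>lborelM I)"
    by (rule nn_integral_cong, rule nn_integral_multc, rule measurable_compose[OF meas1]) measurable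
  also have "\<dots> = (\<integral>\<^sup>+x. (\<integral>\<^sup>+y. f y \<partial>lborelM I) * g (L x) \<partial>lborelM I)"
    by (subst nn_integral_lborelM_shift[OF I]) auto
  also have "\<dots> = (\<integral>\<^sup>+x. g (L x) \<partial>lborelM I) * (\<integral>\<^sup>+x. f x \<partial>lborelM I)"
    by (subst nn_integral_cmult) (auto simp: mult.commute)
  finally show ?thesis .
qed

lemma orthogonal_real_col:
  assumes "orthogonal_real M U" "j < M" "k < M"
  shows "(\<Sum>i<M. U $$ (i, j) * U $$ (i, k)) = (if j = k then 1 else 0)"
proof -
  have U: "U \<in> carrier_mat M M" "transpose_mat U * U = 1\<^sub>m M"
    using assms(1) by (auto simp: orthogonal_real_def)
  have "(transpose_mat U * U) $$ (j, k) = (\<Sum>i<M. U $$ (i, j) * U $$ (i, k))"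
    using U(1) assms(2,3) by (auto simp: scalar_prod_def atLeast0LessThan intro!: sum.cong)
  then show ?thesis
    unfolding U(2) using assms(2,3) by simp
qed

lemma orthogonal_real_transpose: "orthogonal_real M U \<Longrightarrow> orthogonal_real M (transpose_mat U)"
  by (auto simp: orthogonal_real_def)

lemma mat_app_restrict:
  assumes "U \<in> carrier_mat M M"
  shows "mat_app U x = (\<lambda>i\<in>{..<M}. \<Sum>j<M. U $$ (i, j) * x j)"
  using assms by (auto simp: mat_app_def fun_eq_iff)

lemma mat_app_transpose_mat_app:
  assumes U: "orthogonal_real M U" and i: "i < M"
  shows "mat_app (transpose_mat U) (mat_app U x) i = x i"
proof -
  have c: "U \<in> carrier_mat M M" using U by (simp add: orthogonal_real_def)
  have "mat_app (transpose_mat U) (mat_app U x) i = (\<Sum>j<M. U $$ (j, i) * (\<Sum>k<M. U $$ (j, k) * x k))"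
    using c i by (auto simp: mat_app_restrict[of _ M] intro!: sum.cong)
  also have "\<dots> = (\<Sum>j<M. \<Sum>k<M. U $$ (j, i) * U $$ (j, k) * x k)"
    by (simp add: sum_distrib_left mult.assoc)
  also have "\<dots> = (\<Sum>k<M. (\<Sum>j<M. U $$ (j, i) * U $$ (j, k)) * x k)"
    by (subst sum.swap) (simp add: sum_distrib_right)
  also have "\<dots> = (\<Sum>k<M. if k = i then x k else 0)"
    using orthogonal_real_col[OF U i] by (intro sum.cong) auto
  also have "\<dots> = x i" using i by simp
  finally show ?thesis .
qed

lemma sum_squares_mat_app:
  assumes U: "orthogonal_real M U"
  shows "(\<Sum>i<M. (mat_app U x i)\<^sup>2) = (\<Sum>i<M. (x i)\<^sup>2)"
proof -
  have c: "U \<in> carrier_mat M M" using U by (simp add: orthogonal_real_def)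
  have "(\<Sum>i<M. (x i)\<^sup>2) = (\<Sum>i<M. mat_app (transpose_mat U) (mat_app U x) i * x i)"
    by (simp add: mat_app_transpose_mat_app[OF U] power2_eq_square)
  also have "\<dots> = (\<Sum>i<M. \<Sum>j<M. U $$ (j, i) * mat_app U x j * x i)"
    using c by (auto simp: mat_app_restrict[of "transpose_mat U" M] sum_distrib_right intro!: sum.cong)
  also have "\<dots> = (\<Sum>j<M. mat_app U x j * (\<Sum>i<M. U $$ (j, i) * x i))"
    by (subst sum.swap) (simp add: sum_distrib_left mult.assoc mult.left_commute)
  also have "\<dots> = (\<Sum>j<M. (mat_app U x j)\<^sup>2)"
    using c by (auto simp: mat_app_restrict[of U M] power2_eq_square intro!: sum.cong)
  finally show ?thesis ..
qed

lemma measurable_mat_app_lborelM: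
  assumes "U \<in> carrier_mat M M"
  shows "mat_app U \<in> lborelM {..<M} \<rightarrow>\<^sub>M lborelM {..<M}"
proof -
  have "(\<lambda>x. \<lambda>i\<in>{..<M}. \<Sum>j<M. U $$ (i, j) * x j) \<in> lborelM {..<M} \<rightarrow>\<^sub>M lborelM {..<M}"
    by (rule measurable_restrict) measurable
  then show ?thesis
    using mat_app_restrict[OF assms] by (simp add: fun_eq_iff[symmetric] cong: measurable_cong)
qed

lemma measurable_mat_app:
  assumes "U \<in> carrier_mat M M"
  shows "mat_app U \<in> gaussM {..<M} \<rightarrow>\<^sub>M gaussM {..<M}"
  using measurable_mat_app_lborelM[OF assms] measurable_cong_sets[OF sets_gaussM_lborelM sets_gaussM_lborelM] by blast

lemma nn_integral_gaussM_orthogonal: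
  assumes U: "orthogonal_real M U" and g: "g \<in> borel_measurable (gaussM {..<M})"
  shows "(\<integral>\<^sup>+x. g (mat_app U x) \<partial>gaussM {..<M}) = (\<integral>\<^sup>+x. g x \<partial>gaussM {..<M})"
proof -
  let ?I = "{..<M}"
  have c: "U \<in> carrier_mat M M" using U by (simp add: orthogonal_real_def)
  define p where "p x = (\<Prod>i<M. ennreal (exp (- pi * (x i)\<^sup>2)))" for x :: "nat \<Rightarrow> real"
  have p_exp: "p x = ennreal (exp (- pi * (\<Sum>i<M. (x i)\<^sup>2)))" for x
    unfolding p_def by (simp add: prod_ennreal exp_sum[symmetric] sum_distrib_left sum_negf)
  have p_U: "p (mat_app U x) = p x" for x
    unfolding p_exp sum_squares_mat_app[OF U] ..
  have p [measurable]: "p \<in> borel_measurable (lborelM ?I)"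
    unfolding p_def by measurable
  have g' [measurable]: "g \<in> borel_measurable (lborelM ?I)"
    using g measurable_cong_sets[OF sets_gaussM_lborelM refl] by blast
  note L [measurable] = measurable_mat_app_lborelM[OF c]
  have gauss: "(\<integral>\<^sup>+x. f x \<partial>gaussM ?I) = (\<integral>\<^sup>+x. p x * f x \<partial>lborelM ?I)"
    if "f \<in> borel_measurable (lborelM ?I)" for f
    unfolding gaussM_eq_density[OF finite_lessThan] p_def[symmetric]
    by (rule nn_integral_density[OF p that])
  have one: "(\<integral>\<^sup>+x. p x \<partial>lborelM ?I) = 1"
    using gauss[of "\<lambda>_. 1"] prob_space.emeasure_space_1[OF prob_space_gaussM] by simp
  \<comment> \<open>By linearity the translation is t = - U^T y, because U U^T = 1.\<close>
  have surj: "\<exists>t. \<forall>x. mat_app U (\<lambda>i\<in>?I. t i + 1 * x i) = (\<lambda>i\<in>?I. mat_app U x i - y i)" for y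
  proof (intro exI allI)
    fix x
    let ?t = "\<lambda>i. - mat_app (transpose_mat U) y i"
    have Uy: "(\<Sum>j<M. U $$ (i, j) * mat_app (transpose_mat U) y j) = y i" if "i < M" for i
      using mat_app_transpose_mat_app[OF orthogonal_real_transpose[OF U] that, of y] c that
      by (simp add: mat_app_restrict[of U M])
    show "mat_app U (\<lambda>i\<in>?I. ?t i + 1 * x i) = (\<lambda>i\<in>?I. mat_app U x i - y i)"
    proof
      fix i
      show "mat_app U (\<lambda>i\<in>?I. ?t i + 1 * x i) i = (\<lambda>i\<in>?I. mat_app U x i - y i) i"
        using Uy[of i] by (simp add: mat_app_restrict[OF c] algebra_simps sum.distrib sum_subtractf)
    qed
  qed
  have "(\<integral>\<^sup>+x. g (mat_app U x) \<partial>gaussM ?I) = (\<integral>\<^sup>+x. p x * g (mat_app U x) \<partial>lborelM ?I)"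
    by (rule gauss) measurable
  also have "\<dots> = (\<integral>\<^sup>+x. p (mat_app U x) * g (mat_app U x) \<partial>lborelM ?I)"
    by (simp only: p_U)
  also have "\<dots> = (\<integral>\<^sup>+x. p (mat_app U x) * g (mat_app U x) \<partial>lborelM ?I) * (\<integral>\<^sup>+x. p x \<partial>lborelM ?I)"
    by (simp add: one)
  \<comment> \<open>The identity is applied to \<open>p * g\<close> and \<open>p\<close>. As p is
    invariant under U and has integral 1, no factor remains.\<close>
  also have "\<dots> = (\<integral>\<^sup>+x. p (mat_app U x) \<partial>lborelM ?I) * (\<integral>\<^sup>+x. p x * g x \<partial>lborelM ?I)"
    by (rule nn_integral_lborelM_additive[OF finite_lessThan L surj, of "\<lambda>x. p x * g x" p]) measurable
  also have "\<dots> = (\<integral>\<^sup>+x. g x \<partial>gaussM ?I)"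
    unfolding p_U one by (simp add: gauss)
  finally show ?thesis .
qed

lemma distr_gaussM_orthogonal:
  assumes U: "orthogonal_real M U"
  shows "distr (gaussM {..<M}) (gaussM {..<M}) (mat_app U) = gaussM {..<M}" (is "distr ?G ?G _ = ?G")
proof (rule measure_eqI)
  have c: "U \<in> carrier_mat M M" using U by (simp add: orthogonal_real_def)
  note [measurable] = measurable_mat_app[OF c]
  fix A assume "A \<in> sets (distr ?G ?G (mat_app U))"
  then have [measurable]: "A \<in> sets ?G" by simp
  have "emeasure (distr ?G ?G (mat_app U)) A = (\<integral>\<^sup>+x. indicator A x \<partial>distr ?G ?G (mat_app U))"
    by (rule nn_integral_indicator[symmetric]) simp
  also have "\<dots> = (\<integral>\<^sup>+x. indicator A (mat_app U x) \<partial>?G)"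
    by (rule nn_integral_distr) measurable
  also have "\<dots> = (\<integral>\<^sup>+x. indicator A x \<partial>?G)"
    by (rule nn_integral_gaussM_orthogonal[OF U]) measurable
  also have "\<dots> = emeasure ?G A" by simp
  finally show "emeasure (distr ?G ?G (mat_app U)) A = emeasure ?G A" .
qed simp

subsection \<open>Tensorization\<close>

lemma sets_gaussM: "sets (gaussM I) = sets (PiM I (\<lambda>_. borel :: real measure))"
  unfolding gaussM_def by (rule sets_PiM_cong) auto

lemma measurable_gaussM_component:
  assumes "i \<in> I"
  shows "(\<lambda>x. x i) \<in> borel_measurable (gaussM I)"
  using measurable_component_singleton[OF assms, of "\<lambda>_. borel :: real measure"]
  unfolding measurable_cong_sets[OF sets_gaussM refl] .

lemma measurable_gaussM_restrict:
  assumes "\<And>i. i \<in> I \<Longrightarrow> (\<lambda>x. f i x) \<in> borel_measurable N"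
  shows "(\<lambda>x. \<lambda>i\<in>I. f i x) \<in> N \<rightarrow>\<^sub>M gaussM I"
  unfolding measurable_cong_sets[OF refl sets_gaussM] using assms by (rule measurable_restrict)

lemma measurable_gaussM_upd:
  assumes "f \<in> N \<rightarrow>\<^sub>M gaussM I" "g \<in> borel_measurable N"
  shows "(\<lambda>x. (f x)(i := g x)) \<in> N \<rightarrow>\<^sub>M gaussM (insert i I)"
  unfolding measurable_cong_sets[OF refl sets_gaussM]
  by (rule measurable_fun_upd[where J = I])
    (use assms in \<open>auto simp: measurable_cong_sets[OF refl sets_gaussM]\<close>)

lemma measurable_gaussM_merge:
  assumes "f \<in> N \<rightarrow>\<^sub>M gaussM I" "g \<in> N \<rightarrow>\<^sub>M gaussM J"
  shows "(\<lambda>x. merge I J (f x, g x)) \<in> N \<rightarrow>\<^sub>M gaussM (I \<union> J)"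
proof -
  have "(\<lambda>x. (f x, g x)) \<in> N \<rightarrow>\<^sub>M gaussM I \<Otimes>\<^sub>M gaussM J"
    using assms by (rule measurable_Pair)
  then show ?thesis
    unfolding gaussM_def by (rule measurable_compose[OF _ measurable_merge])
qed

lemma measurable_gaussM_merge_Diff:
  assumes "f \<in> N \<rightarrow>\<^sub>M gaussM \<sigma>" "g \<in> N \<rightarrow>\<^sub>M gaussM (I - \<sigma>)" "\<sigma> \<subseteq> I"
  shows "(\<lambda>x. merge \<sigma> (I - \<sigma>) (f x, g x)) \<in> N \<rightarrow>\<^sub>M gaussM I"
  using measurable_gaussM_merge[OF assms(1,2)] assms(3) by (simp add: Un_absorb1)

lemma nn_integral_gaussM_insert:
  assumes "finite I" "i \<notin> I" "f \<in> borel_measurable (gaussM (insert i I))"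
  shows "(\<integral>\<^sup>+x. f x \<partial>gaussM (insert i I)) = (\<integral>\<^sup>+x. \<integral>\<^sup>+y. f (x(i := y)) \<partial>gauss1 \<partial>gaussM I)"
    and "(\<integral>\<^sup>+x. f x \<partial>gaussM (insert i I)) = (\<integral>\<^sup>+y. \<integral>\<^sup>+x. f (x(i := y)) \<partial>gaussM I \<partial>gauss1)"
  using assms gaussP.product_nn_integral_insert gaussP.product_nn_integral_insert_rev
  unfolding gaussM_def by auto

lemma gaussM_Fubini:
  assumes "finite I" "f \<in> borel_measurable (gauss1 \<Otimes>\<^sub>M gaussM I)"
  shows "(\<integral>\<^sup>+x. \<integral>\<^sup>+y. f (y, x) \<partial>gauss1 \<partial>gaussM I) = (\<integral>\<^sup>+y. \<integral>\<^sup>+x. f (y, x) \<partial>gaussM I \<partial>gauss1)"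
proof -
  interpret I: prob_space "gaussM I" by (rule prob_space_gaussM)
  interpret pair_sigma_finite gauss1 "gaussM I" ..
  show ?thesis using Fubini'[of "\<lambda>y x. f (y, x)"] assms by simp
qed

lemma borel_measurable_nn_integral_gaussM:
  assumes "(\<lambda>z. f (fst z) (snd z)) \<in> borel_measurable (N \<Otimes>\<^sub>M gaussM I)"
  shows "(\<lambda>x. \<integral>\<^sup>+y. f x y \<partial>gaussM I) \<in> borel_measurable N"
proof -
  interpret I: prob_space "gaussM I" by (rule prob_space_gaussM)
  show ?thesis by (rule I.borel_measurable_nn_integral) (use assms in \<open>simp add: split_beta'\<close>)
qed

lemma borel_measurable_nn_integral_gauss1:
  assumes "(\<lambda>z. f (fst z) (snd z)) \<in> borel_measurable (N \<Otimes>\<^sub>M gauss1)"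
  shows "(\<lambda>x. \<integral>\<^sup>+y. f x y \<partial>gauss1) \<in> borel_measurable N"
  by (rule gauss1.borel_measurable_nn_integral) (use assms in \<open>simp add: split_beta'\<close>)

definition mix :: "nat set \<Rightarrow> (nat \<Rightarrow> real) \<Rightarrow> (nat \<Rightarrow> real) \<Rightarrow> (nat \<Rightarrow> real) \<Rightarrow> (nat \<Rightarrow> real) \<Rightarrow> nat \<Rightarrow> real" where
  "mix I c s v w = (\<lambda>i\<in>I. c i * v i + s i * w i)"

lemma measurable_mix:
  assumes "f \<in> N \<rightarrow>\<^sub>M gaussM I" "g \<in> N \<rightarrow>\<^sub>M gaussM I"
  shows "(\<lambda>x. mix I c s (f x) (g x)) \<in> N \<rightarrow>\<^sub>M gaussM I"
  unfolding mix_def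
proof (rule measurable_gaussM_restrict)
  fix i assume "i \<in> I"
  then have [measurable]: "(\<lambda>x. f x i) \<in> borel_measurable N" "(\<lambda>x. g x i) \<in> borel_measurable N"
    using assms by (auto intro: measurable_compose[OF _ measurable_gaussM_component])
  show "(\<lambda>x. c i * f x i + s i * g x i) \<in> borel_measurable N" by measurable
qed

lemma mix_insert:
  assumes "i \<notin> I"
  shows "mix (insert i I) c s (v(i := t)) (w(i := y)) = (mix I c s v w)(i := c i * t + s i * y)"
  using assms by (auto simp: mix_def restrict_def fun_eq_iff)

text \<open>Induction on the coordinates. The one-dimensional inequality in the new coordinate i
  gives a term with factor \<open>c i\<close> squared, where i is kept, and one with factor
  \<open>s i\<close> squared, where i is integrated out; they yield the subsets without i and with
  i.\<close>

theorem entropy_product_mehler: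
  fixes c s :: "nat \<Rightarrow> real"
  assumes "finite I" "\<And>i. i \<in> I \<Longrightarrow> (c i)\<^sup>2 + (s i)\<^sup>2 = 1" "h \<in> borel_measurable (gaussM I)"
  shows "(\<integral>\<^sup>+v. ent (\<integral>\<^sup>+w. h (mix I c s v w) \<partial>gaussM I) \<partial>gaussM I)
    \<le> (\<Sum>\<sigma>\<in>Pow I. ennreal ((\<Prod>i\<in>I - \<sigma>. (c i)\<^sup>2) * (\<Prod>j\<in>\<sigma>. (s j)\<^sup>2))
        * (\<integral>\<^sup>+u. ent (\<integral>\<^sup>+w. h (merge \<sigma> (I - \<sigma>) (w, u)) \<partial>gaussM \<sigma>) \<partial>gaussM (I - \<sigma>)))"
  using assms
proof (induction I arbitrary: h rule: finite_induct)
  case empty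
  have "mix {} c s v w = (\<lambda>_. undefined)" "merge {} {} (w, v) = (\<lambda>_. undefined)" for v w :: "nat \<Rightarrow> real"
    by (auto simp: mix_def merge_def)
  then show ?case
    by (simp add: gaussM_def gaussP.nn_integral_empty)
next
  case (insert i I h)
  note I = \<open>finite I\<close> \<open>i \<notin> I\<close>
  have cs: "(c i)\<^sup>2 + (s i)\<^sup>2 = 1" using insert.prems by simp
  note hU = measurable_compose[OF measurable_gaussM_upd insert.prems(2)]
  note ent_meas = measurable_compose[OF _ borel_measurable_ent]
  \<comment> \<open>\<open>G v\<close> is the function of coordinate i on which its own Mehler
    operator still has to act. \<open>H\<close> is \<open>h\<close> with coordinate i integrated
    out, and \<open>B v\<close> is at the same time the smoothing of \<open>H\<close> and, by
    Fubini, the mean of \<open>G v\<close>.\<close>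
  define G where "G v t = (\<integral>\<^sup>+w. h ((mix I c s v w)(i := t)) \<partial>gaussM I)" for v t
  define H where "H z = (\<integral>\<^sup>+t. h (z(i := t)) \<partial>gauss1)" for z
  define B where "B v = (\<integral>\<^sup>+w. H (mix I c s v w) \<partial>gaussM I)" for v
  \<comment> \<open>\<open>C\<close> and \<open>K\<close> are the weights over \<open>I\<close> and
    over \<open>insert i I\<close>, \<open>D\<close> the marginal entropies over
    \<open>insert i I\<close>, and \<open>E\<close> those over \<open>I\<close> of the slice of
    \<open>h\<close> with coordinate i equal to t.\<close>
  define C where "C \<sigma> = ennreal ((\<Prod>i\<in>I - \<sigma>. (c i)\<^sup>2) * (\<Prod>j\<in>\<sigma>. (s j)\<^sup>2))" for \<sigma>
  define K where "K \<sigma> = ennreal ((\<Prod>i\<in>insert i I - \<sigma>. (c i)\<^sup>2) * (\<Prod>j\<in>\<sigma>. (s j)\<^sup>2))" for \<sigma>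
  define D where "D \<sigma> = (\<integral>\<^sup>+u. ent (\<integral>\<^sup>+w. h (merge \<sigma> (insert i I - \<sigma>) (w, u)) \<partial>gaussM \<sigma>) \<partial>gaussM (insert i I - \<sigma>))" for \<sigma>
  define E where "E \<sigma> t = (\<integral>\<^sup>+u. ent (\<integral>\<^sup>+w. h ((merge \<sigma> (I - \<sigma>) (w, u))(i := t)) \<partial>gaussM \<sigma>) \<partial>gaussM (I - \<sigma>))" for \<sigma> t
  have H_meas: "H \<in> borel_measurable (gaussM I)"
    unfolding H_def by (intro borel_measurable_nn_integral_gauss1 hU) measurable
  have G_meas: "(\<lambda>z. G (fst z) (snd z)) \<in> borel_measurable (gaussM I \<Otimes>\<^sub>M gauss1)"
    unfolding G_def by (intro borel_measurable_nn_integral_gaussM hU measurable_mix) measurable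
  have G_meas': "(\<lambda>z. G (snd z) (fst z)) \<in> borel_measurable (gauss1 \<Otimes>\<^sub>M gaussM I)"
    unfolding G_def by (intro borel_measurable_nn_integral_gaussM hU measurable_mix) measurable
  have G_meas1: "G v \<in> borel_measurable borel" if "v \<in> space (gaussM I)" for v
    unfolding G_def by (intro borel_measurable_nn_integral_gaussM hU measurable_mix measurable_const that) measurable
  have B_meas: "B \<in> borel_measurable (gaussM I)"
    unfolding B_def
    by (intro borel_measurable_nn_integral_gaussM measurable_compose[OF measurable_mix H_meas]) measurable
  have one_dim: "(\<integral>\<^sup>+t. ent (\<integral>\<^sup>+w. h (mix (insert i I) c s (v(i := t)) w) \<partial>gaussM (insert i I)) \<partial>gauss1)
      \<le> ennreal ((c i)\<^sup>2) * (\<integral>\<^sup>+t. ent (G v t) \<partial>gauss1) + ennreal ((s i)\<^sup>2) * ent (B v)"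
    if v: "v \<in> space (gaussM I)" for v
  proof -
    have "(\<integral>\<^sup>+w. h (mix (insert i I) c s (v(i := t)) w) \<partial>gaussM (insert i I)) = (\<integral>\<^sup>+y. G v (c i * t + s i * y) \<partial>gauss1)" for t
    proof -
      have "v(i := t) \<in> space (gaussM (insert i I))"
        using v by (auto simp: space_gaussM extensional_def)
      then have "(\<lambda>w. h (mix (insert i I) c s (v(i := t)) w)) \<in> borel_measurable (gaussM (insert i I))"
        by (intro measurable_compose[OF measurable_mix insert.prems(2)] measurable_const) measurable
      then show ?thesis
        unfolding G_def by (subst nn_integral_gaussM_insert(2)[OF I]) (simp_all add: mix_insert[OF I(2)])
    qed
    moreover have "(\<integral>\<^sup>+t. G v t \<partial>gauss1) = B v"
      unfolding G_def B_def H_def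
      by (rule gaussM_Fubini[OF I(1), of "\<lambda>(t, w). h ((mix I c s v w)(i := t))", simplified, symmetric])
        (unfold split_beta', intro hU measurable_mix measurable_const v, measurable)
    ultimately show ?thesis
      using entropy_mehler_ennreal[OF G_meas1[OF v] cs] by simp
  qed
  have ent_G_meas: "(\<lambda>v. \<integral>\<^sup>+t. ent (G v t) \<partial>gauss1) \<in> borel_measurable (gaussM I)"
    by (intro borel_measurable_nn_integral_gauss1 ent_meas G_meas)
  have "(\<integral>\<^sup>+v. ent (\<integral>\<^sup>+w. h (mix (insert i I) c s v w) \<partial>gaussM (insert i I)) \<partial>gaussM (insert i I))
    = (\<integral>\<^sup>+v. \<integral>\<^sup>+t. ent (\<integral>\<^sup>+w. h (mix (insert i I) c s (v(i := t)) w) \<partial>gaussM (insert i I)) \<partial>gauss1 \<partial>gaussM I)"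
    by (rule nn_integral_gaussM_insert(1)[OF I])
      (intro ent_meas borel_measurable_nn_integral_gaussM measurable_compose[OF measurable_mix insert.prems(2)], measurable)
  also have "\<dots> \<le> (\<integral>\<^sup>+v. ennreal ((c i)\<^sup>2) * (\<integral>\<^sup>+t. ent (G v t) \<partial>gauss1) + ennreal ((s i)\<^sup>2) * ent (B v) \<partial>gaussM I)"
    by (rule nn_integral_mono) (rule one_dim)
  also have "\<dots> = ennreal ((c i)\<^sup>2) * (\<integral>\<^sup>+v. \<integral>\<^sup>+t. ent (G v t) \<partial>gauss1 \<partial>gaussM I) + ennreal ((s i)\<^sup>2) * (\<integral>\<^sup>+v. ent (B v) \<partial>gaussM I)"
    using ent_G_meas ent_meas[OF B_meas] by (simp add: nn_integral_add nn_integral_cmult)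
  \<comment> \<open>The induction hypothesis is applied to the slice at each fixed t and then
    integrated over t; the kept variable t joins the variables outside \<sigma>.\<close>
  also have "(\<integral>\<^sup>+v. \<integral>\<^sup>+t. ent (G v t) \<partial>gauss1 \<partial>gaussM I) \<le> (\<Sum>\<sigma>\<in>Pow I. C \<sigma> * D \<sigma>)"
  proof -
    have E_meas: "E \<sigma> \<in> borel_measurable gauss1" if "\<sigma> \<subseteq> I" for \<sigma>
      unfolding E_def
      by (intro borel_measurable_nn_integral_gaussM ent_meas hU measurable_gaussM_merge_Diff[OF _ _ that]) measurable
    have E_D: "(\<integral>\<^sup>+t. E \<sigma> t \<partial>gauss1) = D \<sigma>" if \<sigma>: "\<sigma> \<subseteq> I" for \<sigma>
    proof -
      have eq: "insert i I - \<sigma> = insert i (I - \<sigma>)" using \<sigma> I by auto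
      have upd: "merge \<sigma> (insert i (I - \<sigma>)) (w, u(i := t)) = (merge \<sigma> (I - \<sigma>) (w, u))(i := t)" for w u t
        using \<sigma> I by (auto simp: merge_def fun_eq_iff)
      have m: "(\<lambda>u. ent (\<integral>\<^sup>+w. h (merge \<sigma> (insert i I - \<sigma>) (w, u)) \<partial>gaussM \<sigma>)) \<in> borel_measurable (gaussM (insert i I - \<sigma>))"
        by (intro ent_meas borel_measurable_nn_integral_gaussM measurable_compose[OF measurable_gaussM_merge_Diff insert.prems(2)])
          (use \<sigma> in \<open>auto intro: measurable_fst measurable_snd\<close>)
      show ?thesis
        unfolding D_def E_def using I m
        unfolding eq by (subst nn_integral_gaussM_insert(2)) (auto simp: upd)
    qed
    have "(\<integral>\<^sup>+v. \<integral>\<^sup>+t. ent (G v t) \<partial>gauss1 \<partial>gaussM I) = (\<integral>\<^sup>+t. \<integral>\<^sup>+v. ent (G v t) \<partial>gaussM I \<partial>gauss1)"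
      using gaussM_Fubini[OF I(1) ent_meas[OF G_meas']] by simp
    also have "\<dots> \<le> (\<integral>\<^sup>+t. (\<Sum>\<sigma>\<in>Pow I. C \<sigma> * E \<sigma> t) \<partial>gauss1)"
    proof (rule nn_integral_mono)
      fix t
      have "(\<lambda>z. h (z(i := t))) \<in> borel_measurable (gaussM I)"
        by (intro hU) measurable
      then show "(\<integral>\<^sup>+v. ent (G v t) \<partial>gaussM I) \<le> (\<Sum>\<sigma>\<in>Pow I. C \<sigma> * E \<sigma> t)"
        unfolding G_def C_def E_def by (rule insert.IH[rotated]) (rule insert.prems(1), simp)
    qed
    also have "\<dots> = (\<Sum>\<sigma>\<in>Pow I. C \<sigma> * (\<integral>\<^sup>+t. E \<sigma> t \<partial>gauss1))"
      using E_meas by (subst nn_integral_sum) (auto simp: nn_integral_cmult intro!: sum.cong)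
    also have "\<dots> = (\<Sum>\<sigma>\<in>Pow I. C \<sigma> * D \<sigma>)"
      using E_D by (intro sum.cong) auto
    finally show ?thesis .
  qed
  \<comment> \<open>Here the induction hypothesis is applied to \<open>H\<close>: integrating over
    \<sigma> and over i is integrating over \<open>insert i \<sigma>\<close>.\<close>
  also have "(\<integral>\<^sup>+v. ent (B v) \<partial>gaussM I) \<le> (\<Sum>\<sigma>\<in>Pow I. C \<sigma> * D (insert i \<sigma>))"
  proof -
    have "(\<integral>\<^sup>+u. ent (\<integral>\<^sup>+w. H (merge \<sigma> (I - \<sigma>) (w, u)) \<partial>gaussM \<sigma>) \<partial>gaussM (I - \<sigma>)) = D (insert i \<sigma>)"
      if \<sigma>: "\<sigma> \<subseteq> I" for \<sigma>
    proof -
      have eq: "insert i I - insert i \<sigma> = I - \<sigma>" using \<sigma> I by auto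
      have upd: "merge (insert i \<sigma>) (I - \<sigma>) (w(i := t), u) = (merge \<sigma> (I - \<sigma>) (w, u))(i := t)" for w u t
        using \<sigma> I by (auto simp: merge_def fun_eq_iff)
      have fin: "finite \<sigma>" "i \<notin> \<sigma>" using \<sigma> I finite_subset by auto
      have "(\<integral>\<^sup>+w. h (merge (insert i \<sigma>) (I - \<sigma>) (w, u)) \<partial>gaussM (insert i \<sigma>)) = (\<integral>\<^sup>+w. H (merge \<sigma> (I - \<sigma>) (w, u)) \<partial>gaussM \<sigma>)"
        if u: "u \<in> space (gaussM (I - \<sigma>))" for u
      proof -
        have "(\<lambda>w. h (merge (insert i \<sigma>) (insert i I - insert i \<sigma>) (w, u))) \<in> borel_measurable (gaussM (insert i \<sigma>))"
          by (intro measurable_compose[OF measurable_gaussM_merge_Diff insert.prems(2)])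
            (use \<sigma> u in \<open>auto simp: eq intro: measurable_const measurable_ident\<close>)
        then show ?thesis
          unfolding H_def eq by (subst nn_integral_gaussM_insert(1)[OF fin]) (auto simp: upd)
      qed
      then show ?thesis
        unfolding D_def eq by (intro nn_integral_cong) simp
    qed
    then show ?thesis
      using insert.IH[OF _ H_meas] insert.prems(1) unfolding B_def C_def by simp
  qed
  also have "ennreal ((c i)\<^sup>2) * (\<Sum>\<sigma>\<in>Pow I. C \<sigma> * D \<sigma>) + ennreal ((s i)\<^sup>2) * (\<Sum>\<sigma>\<in>Pow I. C \<sigma> * D (insert i \<sigma>))
    = (\<Sum>\<sigma>\<in>Pow I. K \<sigma> * D \<sigma>) + (\<Sum>\<sigma>\<in>Pow I. K (insert i \<sigma>) * D (insert i \<sigma>))"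
  proof -
    have "K \<sigma> = ennreal ((c i)\<^sup>2) * C \<sigma>" "K (insert i \<sigma>) = ennreal ((s i)\<^sup>2) * C \<sigma>" if \<sigma>: "\<sigma> \<subseteq> I" for \<sigma>
    proof -
      have "insert i I - \<sigma> = insert i (I - \<sigma>)" "insert i I - insert i \<sigma> = I - \<sigma>" "finite \<sigma>" "i \<notin> \<sigma>"
        using \<sigma> I finite_subset by auto
      then show "K \<sigma> = ennreal ((c i)\<^sup>2) * C \<sigma>" "K (insert i \<sigma>) = ennreal ((s i)\<^sup>2) * C \<sigma>"
        unfolding K_def C_def using I
        by (simp_all add: ennreal_mult'[symmetric] prod_nonneg mult.assoc mult.left_commute)
    qed
    then show ?thesis
      by (simp add: sum_distrib_left mult.assoc)
  qed
  \<comment> \<open>Subsets of \<open>insert i I\<close> are those without i and, disjoint from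
    them, those obtained by inserting i.\<close>
  also have "\<dots> = (\<Sum>\<sigma>\<in>Pow (insert i I). K \<sigma> * D \<sigma>)"
  proof -
    have "inj_on (insert i) (Pow I)" "Pow I \<inter> insert i ` Pow I = {}"
      using I by (auto simp: inj_on_def)
    then show ?thesis
      unfolding Pow_insert using I by (subst sum.union_disjoint) (auto simp: sum.reindex)
  qed
  \<comment> \<open>Two links of the chain enlarge only a subterm, which leaves monotonicity of sum
    and product to be shown.\<close>
  finally show ?case
    unfolding K_def D_def by (simp add: add_mono mult_left_mono)
qed

section \<open>Entropies of marginals and conclusion\<close>

lemma nn_integral_gaussM_merge:
  assumes "finite I" "\<sigma> \<subseteq> I" "f \<in> borel_measurable (gaussM I)"
  shows "(\<integral>\<^sup>+x. f x \<partial>gaussM I) = (\<integral>\<^sup>+u. \<integral>\<^sup>+w. f (merge \<sigma> (I - \<sigma>) (w, u)) \<partial>gaussM \<sigma> \<partial>gaussM (I - \<sigma>))"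
proof -
  have eq: "(I - \<sigma>) \<union> \<sigma> = I" "(I - \<sigma>) \<inter> \<sigma> = {}" "finite \<sigma>" using assms finite_subset by auto
  have "merge (I - \<sigma>) \<sigma> (u, w) = merge \<sigma> (I - \<sigma>) (w, u)" for u w :: "nat \<Rightarrow> real"
    by (rule merge_commute) auto
  then show ?thesis
    using gaussP.product_nn_integral_fold[of "I - \<sigma>" \<sigma> f] assms eq unfolding gaussM_def by simp
qed

lemma integral_gaussM_merge:
  fixes f :: "(nat \<Rightarrow> real) \<Rightarrow> real"
  assumes "finite I" "\<sigma> \<subseteq> I" "integrable (gaussM I) f"
  shows "(\<integral>x. f x \<partial>gaussM I) = (\<integral>u. \<integral>w. f (merge \<sigma> (I - \<sigma>) (w, u)) \<partial>gaussM \<sigma> \<partial>gaussM (I - \<sigma>))"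
proof -
  have eq: "(I - \<sigma>) \<union> \<sigma> = I" "(I - \<sigma>) \<inter> \<sigma> = {}" "finite \<sigma>" using assms finite_subset by auto
  have "merge (I - \<sigma>) \<sigma> (u, w) = merge \<sigma> (I - \<sigma>) (w, u)" for u w :: "nat \<Rightarrow> real"
    by (rule merge_commute) auto
  then show ?thesis
    using gaussP.product_integral_fold[of "I - \<sigma>" \<sigma> f] assms eq unfolding gaussM_def by simp
qed

lemma measurable_gaussM_restrict_subset:
  "J \<subseteq> I \<Longrightarrow> (\<lambda>x. restrict x J) \<in> gaussM I \<rightarrow>\<^sub>M gaussM J"
  unfolding gaussM_def by (rule measurable_restrict_subset)

text \<open>The logarithm depends only on the variables outside \<sigma>, so integrating over
  \<sigma> replaces the factor \<open>H\<close> by its marginal, and \<open>R\<close> is the entropy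
  of the marginal. Fubini requires integrability of the product, which follows from Jensen's
  inequality.\<close>

lemma ent_marginal:
  fixes H :: "(nat \<Rightarrow> real) \<Rightarrow> real"
  assumes \<sigma>: "\<sigma> \<subseteq> {..<M}"
    and H [measurable]: "H \<in> borel_measurable (gaussM {..<M})"
    and H_nonneg: "\<And>x. x \<in> space (gaussM {..<M}) \<Longrightarrow> 0 \<le> H x"
    and fin: "(\<integral>\<^sup>+x. ent (ennreal (H x)) \<partial>gaussM {..<M}) < \<infinity>"
  defines "R \<equiv> \<integral>x. H x * ln (marginal M \<sigma> H (restrict x ({..<M} - \<sigma>))) \<partial>gaussM {..<M}"
  shows "(\<lambda>x. marginal M \<sigma> H (restrict x ({..<M} - \<sigma>))) \<in> borel_measurable (gaussM {..<M})"
    and "0 \<le> R + 1"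
    and "(\<integral>\<^sup>+u. ent (\<integral>\<^sup>+w. ennreal (H (merge \<sigma> ({..<M} - \<sigma>) (w, u))) \<partial>gaussM \<sigma>) \<partial>gaussM ({..<M} - \<sigma>)) = ennreal (R + 1)"
proof -
  let ?I = "{..<M}" let ?J = "{..<M} - \<sigma>"
  interpret J: prob_space "gaussM ?J" by (rule prob_space_gaussM)
  interpret S: prob_space "gaussM \<sigma>" by (rule prob_space_gaussM)
  define F where "F u = (\<integral>\<^sup>+w. ennreal (H (merge \<sigma> ?J (w, u))) \<partial>gaussM \<sigma>)" for u
  define k where "k = marginal M \<sigma> H"
  note merge_meas = measurable_gaussM_merge_Diff[OF _ _ \<sigma>]
  have HH: "(\<lambda>z. H (merge \<sigma> ?J (snd z, fst z))) \<in> borel_measurable (gaussM ?J \<Otimes>\<^sub>M gaussM \<sigma>)"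
    by (intro measurable_compose[OF merge_meas H]) measurable
  have Hu: "(\<lambda>w. H (merge \<sigma> ?J (w, u))) \<in> borel_measurable (gaussM \<sigma>)" if "u \<in> space (gaussM ?J)" for u
    by (intro measurable_compose[OF merge_meas H] measurable_const that) measurable
  have merge_space: "merge \<sigma> ?J (w, u) \<in> space (gaussM ?I)" for w u
    using \<sigma> by (auto simp: space_gaussM merge_def extensional_def)
  have F_meas [measurable]: "F \<in> borel_measurable (gaussM ?J)"
    unfolding F_def
    by (intro borel_measurable_nn_integral_gaussM measurable_compose[OF _ measurable_ennreal] HH)
  \<comment> \<open>This holds also where \<open>F u\<close> is infinite: the Bochner integral and
    \<open>enn2real\<close> are then both 0.\<close>
  have k: "k u = enn2real (F u)" if "u \<in> space (gaussM ?J)" for u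
    unfolding k_def marginal_def F_def
    by (rule integral_eq_nn_integral) (use Hu[OF that] H_nonneg merge_space in auto)
  have k_meas [measurable]: "k \<in> borel_measurable (gaussM ?J)"
    using k by (subst measurable_cong[of _ _ "\<lambda>u. enn2real (F u)"]) auto
  show km: "(\<lambda>x. marginal M \<sigma> H (restrict x ?J)) \<in> borel_measurable (gaussM ?I)"
    using measurable_compose[OF measurable_gaussM_restrict_subset k_meas, of ?I] by (simp add: k_def)
  have "(\<integral>\<^sup>+u. ent (F u) \<partial>gaussM ?J) \<le> (\<integral>\<^sup>+u. \<integral>\<^sup>+w. ent (ennreal (H (merge \<sigma> ?J (w, u)))) \<partial>gaussM \<sigma> \<partial>gaussM ?J)"
    unfolding F_def by (intro nn_integral_mono S.jensen_ent measurable_compose[OF Hu measurable_ennreal])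
  also have "\<dots> = (\<integral>\<^sup>+x. ent (ennreal (H x)) \<partial>gaussM ?I)"
    by (rule nn_integral_gaussM_merge[symmetric]) (use \<sigma> in auto)
  finally have F_fin: "(\<integral>\<^sup>+u. ent (F u) \<partial>gaussM ?J) < \<infinity>"
    using fin by (rule le_less_trans)
  note F = J.ent_finite[OF F_meas F_fin]
  have k_int: "integrable (gaussM ?J) (\<lambda>u. k u * ln (k u))"
    using F(3) k by (subst Bochner_Integration.integrable_cong[OF refl]) auto
  have restr: "restrict (merge \<sigma> ?J (w, u)) ?J = u" if "u \<in> space (gaussM ?J)" for w u
    using that by (auto simp: space_gaussM merge_def extensional_def restrict_def fun_eq_iff)
  define f where "f x = H x * ln (k (restrict x ?J))" for x
  have f_meas: "f \<in> borel_measurable (gaussM ?I)"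
    unfolding f_def k_def using km by measurable
  \<comment> \<open>By Tonelli the integral of the absolute value is that of |k ln k|, since the
    inner integral of \<open>H\<close> is almost everywhere k.\<close>
  have f_int: "integrable (gaussM ?I) f"
  proof (rule integrableI_bounded[OF f_meas])
    have "(\<integral>\<^sup>+x. ennreal (norm (f x)) \<partial>gaussM ?I)
      = (\<integral>\<^sup>+u. \<integral>\<^sup>+w. ennreal (norm (f (merge \<sigma> ?J (w, u)))) \<partial>gaussM \<sigma> \<partial>gaussM ?J)"
      by (rule nn_integral_gaussM_merge) (use \<sigma> f_meas in auto)
    also have "\<dots> = (\<integral>\<^sup>+u. F u * ennreal \<bar>ln (k u)\<bar> \<partial>gaussM ?J)"
    proof (rule nn_integral_cong)
      fix u assume u: "u \<in> space (gaussM ?J)"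
      have "(\<integral>\<^sup>+w. ennreal (norm (f (merge \<sigma> ?J (w, u)))) \<partial>gaussM \<sigma>)
        = (\<integral>\<^sup>+w. ennreal (H (merge \<sigma> ?J (w, u))) * ennreal \<bar>ln (k u)\<bar> \<partial>gaussM \<sigma>)"
        unfolding f_def restr[OF u]
        by (rule nn_integral_cong) (simp add: abs_mult ennreal_mult H_nonneg merge_space)
      also have "\<dots> = F u * ennreal \<bar>ln (k u)\<bar>"
        unfolding F_def by (rule nn_integral_multc) (use Hu[OF u] in measurable)
      finally show "(\<integral>\<^sup>+w. ennreal (norm (f (merge \<sigma> ?J (w, u)))) \<partial>gaussM \<sigma>) = F u * ennreal \<bar>ln (k u)\<bar>" .
    qed
    also have "\<dots> = (\<integral>\<^sup>+u. ennreal (norm (k u * ln (k u))) \<partial>gaussM ?J)"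
    proof (rule nn_integral_cong_AE)
      show "AE u in gaussM ?J. F u * ennreal \<bar>ln (k u)\<bar> = ennreal (norm (k u * ln (k u)))"
        using F(1) AE_space
      proof eventually_elim
        fix u assume "F u = ennreal (enn2real (F u))" "u \<in> space (gaussM ?J)"
        then have "F u = ennreal (k u)" "0 \<le> k u" using k by auto
        then show "F u * ennreal \<bar>ln (k u)\<bar> = ennreal (norm (k u * ln (k u)))"
          by (simp add: abs_mult ennreal_mult)
      qed
    qed
    also have "\<dots> < \<infinity>"
      using k_int by (simp add: integrable_iff_bounded)
    finally show "(\<integral>\<^sup>+x. ennreal (norm (f x)) \<partial>gaussM ?I) < \<infinity>" .
  qed
  have "R = (\<integral>x. f x \<partial>gaussM ?I)"
    by (simp add: R_def f_def k_def)
  also have "\<dots> = (\<integral>u. \<integral>w. f (merge \<sigma> ?J (w, u)) \<partial>gaussM \<sigma> \<partial>gaussM ?J)"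
    by (rule integral_gaussM_merge) (use \<sigma> f_int in auto)
  also have "\<dots> = (\<integral>u. k u * ln (k u) \<partial>gaussM ?J)"
  proof (rule Bochner_Integration.integral_cong[OF refl])
    fix u assume u: "u \<in> space (gaussM ?J)"
    have "(\<integral>w. f (merge \<sigma> ?J (w, u)) \<partial>gaussM \<sigma>) = (\<integral>w. H (merge \<sigma> ?J (w, u)) * ln (k u) \<partial>gaussM \<sigma>)"
      unfolding f_def restr[OF u] ..
    also have "\<dots> = (\<integral>w. H (merge \<sigma> ?J (w, u)) \<partial>gaussM \<sigma>) * ln (k u)"
      by simp
    finally show "(\<integral>w. f (merge \<sigma> ?J (w, u)) \<partial>gaussM \<sigma>) = k u * ln (k u)"
      by (simp add: k_def marginal_def)
  qed
  also have "\<dots> = (\<integral>u. enn2real (F u) * ln (enn2real (F u)) \<partial>gaussM ?J)"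
    by (rule Bochner_Integration.integral_cong[OF refl]) (simp add: k)
  finally have R: "R = (\<integral>u. enn2real (F u) * ln (enn2real (F u)) \<partial>gaussM ?J)" .
  show "0 \<le> R + 1" "(\<integral>\<^sup>+u. ent (\<integral>\<^sup>+w. ennreal (H (merge \<sigma> ?J (w, u))) \<partial>gaussM \<sigma>) \<partial>gaussM ?J) = ennreal (R + 1)"
    using F(5,6) unfolding R F_def by auto
qed

theorem theorem4p1:
  fixes M N k :: nat and \<alpha>s :: "(nat \<times> nat) list" and \<theta>s :: "real list"
    and h0 :: "(nat \<Rightarrow> real) \<Rightarrow> real" and U V \<Gamma> :: "real mat"
  assumes "0 < M" and "0 < N"
    and h0_meas: "h0 \<in> borel_measurable (gaussM {..<M})"
    and h0_nonneg: "\<forall>v \<in> space (gaussM {..<M}). 0 \<le> h0 v"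
    and h0_L1: "integrable (gaussM {..<M}) h0"
    and h0_S: "(\<integral>\<^sup>+ v. ennreal (h0 v * ln (h0 v)) \<partial>gaussM {..<M}) < \<infinity>"
    and len: "length \<alpha>s = k" "length \<theta>s = k"
    and pairs: "\<forall>(i,j) \<in> set \<alpha>s. i < j \<and> j < M + N"
    and svd: "A_blk M N \<alpha>s \<theta>s = U * \<Gamma> * transpose_mat V"
    and U: "orthogonal_real M U" and V: "orthogonal_real M V"
    and Gam: "\<Gamma> \<in> carrier_mat M M" "diagonal_mat \<Gamma>"
      "\<forall>i<M. 0 \<le> \<Gamma> $$ (i,i) \<and> \<Gamma> $$ (i,i) \<le> 1"
  shows "entropy M (g_fun M h0 U \<Gamma>) \<le>
    (\<Sum>\<sigma> \<in> Pow {..<M}.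
       (\<Prod>i \<in> {..<M} - \<sigma>. (\<Gamma> $$ (i,i))^2) * (\<Prod>j \<in> \<sigma>. 1 - (\<Gamma> $$ (j,j))^2) *
       (\<integral>v. h0 v * ln (marginal M \<sigma> (hU h0 U) (proj_c M \<sigma> (mat_app (transpose_mat U) v)))
          \<partial>gaussM {..<M}))"
proof -
  let ?I = "{..<M}" let ?G = "gaussM {..<M}"
  interpret G: prob_space ?G by (rule prob_space_gaussM)
  define H where "H = hU h0 U"
  define c where "c i = \<Gamma> $$ (i, i)" for i
  define s where "s i = sqrt (1 - (\<Gamma> $$ (i, i))\<^sup>2)" for i
  have Ucar: "U \<in> carrier_mat M M" "transpose_mat U \<in> carrier_mat M M"
    using U by (auto simp: orthogonal_real_def)
  note [measurable] = measurable_mat_app[OF Ucar(1)] measurable_mat_app[OF Ucar(2)] h0_meas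
  have H_meas [measurable]: "H \<in> borel_measurable ?G"
    unfolding H_def hU_def by measurable
  have H_nonneg: "0 \<le> H x" if "x \<in> space ?G" for x
    using h0_nonneg measurable_space[OF measurable_mat_app[OF Ucar(1)] that] by (simp add: H_def hU_def)
  have s2: "(s i)\<^sup>2 = 1 - (\<Gamma> $$ (i, i))\<^sup>2" if "i < M" for i
    using Gam(3) that unfolding s_def by (subst real_sqrt_pow2) (auto simp: power_le_one)
  have cs: "(c i)\<^sup>2 + (s i)\<^sup>2 = 1" if "i \<in> ?I" for i
    using s2[of i] that by (simp add: c_def)
  have "(\<integral>\<^sup>+x. ent (ennreal (H x)) \<partial>?G) = (\<integral>\<^sup>+x. ent (ennreal (h0 x)) \<partial>?G)"
    unfolding H_def hU_def by (rule nn_integral_gaussM_orthogonal[OF U]) measurable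
  \<comment> \<open>\<open>h0_S\<close> bounds the positive part of the integrand. Where h0 ln h0 is
    negative, its \<open>ennreal\<close> is 0 and the summand 1 alone bounds
    \<open>ent\<close>.\<close>
  also have "\<dots> \<le> (\<integral>\<^sup>+x. ennreal (h0 x * ln (h0 x)) + 1 \<partial>?G)"
  proof (rule nn_integral_mono)
    fix x assume "x \<in> space ?G"
    then have "ent (ennreal (h0 x)) = ennreal (h0 x * ln (h0 x) + 1)"
      using h0_nonneg by (simp add: ent_ennreal)
    also have "\<dots> \<le> ennreal (h0 x * ln (h0 x)) + 1"
    proof (cases "0 \<le> h0 x * ln (h0 x)")
      case False
      then have "ennreal (h0 x * ln (h0 x) + 1) \<le> ennreal 1" by (intro ennreal_leI) simp
      then show ?thesis by (simp add: add_increasing)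
    qed (simp add: ennreal_plus)
    finally show "ent (ennreal (h0 x)) \<le> ennreal (h0 x * ln (h0 x)) + 1" .
  qed
  also have "\<dots> = (\<integral>\<^sup>+x. ennreal (h0 x * ln (h0 x)) \<partial>?G) + 1"
    by (subst nn_integral_add) (auto simp: G.emeasure_space_1)
  also have "\<dots> < \<infinity>" using h0_S by simp
  finally have H_fin: "(\<integral>\<^sup>+x. ent (ennreal (H x)) \<partial>?G) < \<infinity>" .

  define R where "R \<sigma> = (\<integral>v. h0 v * ln (marginal M \<sigma> (hU h0 U) (proj_c M \<sigma> (mat_app (transpose_mat U) v))) \<partial>?G)" for \<sigma>
  define C where "C \<sigma> = (\<Prod>i\<in>?I - \<sigma>. (c i)\<^sup>2) * (\<Prod>j\<in>\<sigma>. (s j)\<^sup>2)" for \<sigma>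
  have C_nonneg: "0 \<le> C \<sigma>" for \<sigma>
    unfolding C_def by (simp add: prod_nonneg)
  \<comment> \<open>Expanding the product of the sums s^2 + c^2 = 1 over all coordinates gives the
    weights; their total 1 is what lets the shift cancel.\<close>
  have "(\<Sum>\<sigma>\<in>Pow ?I. C \<sigma>) = (\<Prod>i\<in>?I. (s i)\<^sup>2 + (c i)\<^sup>2)"
    unfolding C_def by (subst prod_add) (simp_all add: mult.commute)
  also have "\<dots> = 1"
    using cs by (intro prod.neutral) (auto simp: add.commute)
  finally have C_sum: "(\<Sum>\<sigma>\<in>Pow ?I. C \<sigma>) = 1" .
  have R: "0 \<le> R \<sigma> + 1"
    "(\<integral>\<^sup>+u. ent (\<integral>\<^sup>+w. ennreal (H (merge \<sigma> (?I - \<sigma>) (w, u))) \<partial>gaussM \<sigma>) \<partial>gaussM (?I - \<sigma>)) = ennreal (R \<sigma> + 1)"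
    if \<sigma>: "\<sigma> \<subseteq> ?I" for \<sigma>
  proof -
    note E = ent_marginal[OF \<sigma> H_meas H_nonneg H_fin]
    \<comment> \<open>After the substitution v = U x the projection acts on U^T U x = x, so the
      integral on the right is the one over \<open>H\<close> treated in
      \<open>ent_marginal\<close>.\<close>
    have proj: "proj_c M \<sigma> (mat_app (transpose_mat U) (mat_app U x)) = restrict x (?I - \<sigma>)" for x
      using mat_app_transpose_mat_app[OF U] by (auto simp: proj_c_def restrict_def fun_eq_iff)
    let ?f = "\<lambda>v. h0 v * ln (marginal M \<sigma> (hU h0 U) (proj_c M \<sigma> (mat_app (transpose_mat U) v)))"
    have "(\<lambda>v. marginal M \<sigma> (hU h0 U) (proj_c M \<sigma> (mat_app (transpose_mat U) v))) \<in> borel_measurable ?G"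
      unfolding proj_c_def H_def[symmetric]
      by (rule measurable_compose[OF measurable_mat_app[OF Ucar(2)] E(1)])
    then have f_meas: "?f \<in> borel_measurable ?G" by measurable
    have "R \<sigma> = (\<integral>v. ?f v \<partial>distr ?G ?G (mat_app U))"
      unfolding R_def distr_gaussM_orthogonal[OF U] ..
    also have "\<dots> = (\<integral>x. ?f (mat_app U x) \<partial>?G)"
      by (rule integral_distr[OF measurable_mat_app[OF Ucar(1)] f_meas])
    also have "\<dots> = (\<integral>x. H x * ln (marginal M \<sigma> H (restrict x (?I - \<sigma>))) \<partial>?G)"
      by (simp add: proj H_def hU_def[of h0 U])
    finally have R: "R \<sigma> = (\<integral>x. H x * ln (marginal M \<sigma> H (restrict x (?I - \<sigma>))) \<partial>?G)" .
    show "0 \<le> R \<sigma> + 1"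
      "(\<integral>\<^sup>+u. ent (\<integral>\<^sup>+w. ennreal (H (merge \<sigma> (?I - \<sigma>) (w, u))) \<partial>gaussM \<sigma>) \<partial>gaussM (?I - \<sigma>)) = ennreal (R \<sigma> + 1)"
      unfolding R using E(2,3) by auto
  qed

  define T where "T v = (\<integral>\<^sup>+w. ennreal (H (mix ?I c s v w)) \<partial>?G)" for v
  have T_meas: "T \<in> borel_measurable ?G"
    unfolding T_def
    by (intro borel_measurable_nn_integral_gaussM measurable_compose[OF _ measurable_ennreal]
        measurable_compose[OF measurable_mix H_meas]) measurable
  \<comment> \<open>Again both sides are 0 where \<open>T v\<close> is infinite, so the equality
    holds at every point of the space.\<close>
  have g: "g_fun M h0 U \<Gamma> v = enn2real (T v)" if v: "v \<in> space ?G" for v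
  proof -
    have eq: "(\<lambda>i. if i < M then \<Gamma> $$ (i,i) * v i + sqrt (1 - (\<Gamma> $$ (i,i))\<^sup>2) * w i else undefined) = mix ?I c s v w" for w
      by (auto simp: mix_def c_def s_def fun_eq_iff)
    show ?thesis
      unfolding g_fun_def T_def eq H_def[symmetric]
    proof (rule integral_eq_nn_integral)
      show "(\<lambda>w. H (mix ?I c s v w)) \<in> borel_measurable ?G"
        by (intro measurable_compose[OF measurable_mix H_meas] measurable_const v) measurable
      show "AE w in ?G. 0 \<le> H (mix ?I c s v w)"
        by (intro AE_I2 H_nonneg) (simp add: space_gaussM mix_def)
    qed
  qed
  have "(\<integral>\<^sup>+v. ent (T v) \<partial>?G) \<le> (\<Sum>\<sigma>\<in>Pow ?I. ennreal (C \<sigma>)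
      * (\<integral>\<^sup>+u. ent (\<integral>\<^sup>+w. ennreal (H (merge \<sigma> (?I - \<sigma>) (w, u))) \<partial>gaussM \<sigma>) \<partial>gaussM (?I - \<sigma>)))"
    unfolding T_def C_def
    by (rule entropy_product_mehler[of ?I c s "\<lambda>x. ennreal (H x)"]) (use cs in auto)
  also have "\<dots> = (\<Sum>\<sigma>\<in>Pow ?I. ennreal (C \<sigma> * (R \<sigma> + 1)))"
    using R C_nonneg by (intro sum.cong) (auto simp: ennreal_mult)
  also have "\<dots> = ennreal (\<Sum>\<sigma>\<in>Pow ?I. C \<sigma> * (R \<sigma> + 1))"
    using R C_nonneg by (intro sum_ennreal) auto
  also have "(\<Sum>\<sigma>\<in>Pow ?I. C \<sigma> * (R \<sigma> + 1)) = (\<Sum>\<sigma>\<in>Pow ?I. C \<sigma> * R \<sigma>) + 1"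
    using C_sum by (simp add: distrib_left sum.distrib)
  finally have le: "(\<integral>\<^sup>+v. ent (T v) \<partial>?G) \<le> ennreal ((\<Sum>\<sigma>\<in>Pow ?I. C \<sigma> * R \<sigma>) + 1)" .
  then have T_fin: "(\<integral>\<^sup>+v. ent (T v) \<partial>?G) < \<infinity>"
    by (rule le_less_trans) simp
  have "0 \<le> (\<Sum>\<sigma>\<in>Pow ?I. C \<sigma> * (R \<sigma> + 1))"
    using R C_nonneg by (intro sum_nonneg mult_nonneg_nonneg) auto
  then have nn: "0 \<le> (\<Sum>\<sigma>\<in>Pow ?I. C \<sigma> * R \<sigma>) + 1"
    using C_sum by (simp add: distrib_left sum.distrib)
  have "entropy M (g_fun M h0 U \<Gamma>) = (\<integral>v. enn2real (T v) * ln (enn2real (T v)) \<partial>?G)"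
    unfolding entropy_def by (rule Bochner_Integration.integral_cong[OF refl]) (simp add: g)
  \<comment> \<open>Both integrals of \<open>ent\<close> carry the same shift 1; nonnegativity of
    the right side allows the comparison to descend from \<open>ennreal\<close> to the
    reals.\<close>
  also have "\<dots> \<le> (\<Sum>\<sigma>\<in>Pow ?I. C \<sigma> * R \<sigma>)"
    using le unfolding G.ent_finite(6)[OF T_meas T_fin] ennreal_le_iff[OF nn] by simp
  also have "\<dots> = (\<Sum>\<sigma> \<in> Pow {..<M}.
       (\<Prod>i \<in> {..<M} - \<sigma>. (\<Gamma> $$ (i,i))^2) * (\<Prod>j \<in> \<sigma>. 1 - (\<Gamma> $$ (j,j))^2) * R \<sigma>)"
  proof (rule sum.cong[OF refl])
    fix \<sigma> assume "\<sigma> \<in> Pow ?I"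
    then have "(\<Prod>j\<in>\<sigma>. (s j)\<^sup>2) = (\<Prod>j\<in>\<sigma>. 1 - (\<Gamma> $$ (j,j))\<^sup>2)"
      by (intro prod.cong refl s2) auto
    then show "C \<sigma> * R \<sigma> = (\<Prod>i\<in>?I - \<sigma>. (\<Gamma> $$ (i,i))\<^sup>2) * (\<Prod>j\<in>\<sigma>. 1 - (\<Gamma> $$ (j,j))\<^sup>2) * R \<sigma>"
      unfolding C_def c_def by simp
  qed
  finally show ?thesis
    unfolding R_def .
qed

end
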